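(* For integers $n,r$, let $\widetilde{\mathrm N}_{n,r}=\mathrm N_{n,r}/\langle\langle x_1^2,\ldots,x_n^2\rangle\rangle$, where $\mathrm N_{n,r}$ is the free $r$-step nilpotent group of rank $n$ with basis $x_1,\ldots,x_n$, and let $Y=\{y_1,\ldots,y_n\}$ be the image of $\{x_1,\ldots,x_n\}$ in $\widetilde{\mathrm N}_{n,r}$. Then: (1) For all $n,r\ge 2$, $\ n\le \mathrm{pw}(\widetilde{\mathrm N}_{n,r},Y)\le 2n$. (2) For all $n\ge 2$, $\ \mathrm{pw}(\widetilde{\mathrm N}_{n,2},Y)=2(n-1)$.
   Context: Let $G$ be a group with generating set $S$. A (freely) reduced word in the alphabet $S^{\pm1}$ is a palindrome if it reads the same left-to-right and right-to-left; an element of $G$ is a palindrome (with respect to $S$) if it is represented by some palindromic word in $S^{\pm1}$. The palindromic length $l_{\mathcal P}(g)$ of $g\in G$ is the minimal $k$ such that $g$ is a product of $k$ palindromes, and the palindromic width is $\mathrm{pw}(G,S)=\sup_{g\in G} l_{\mathcal P}(g)$. The free $r$-step nilpotent group of rank $n$ is $\mathrm N_{n,r}=F_n/\gamma_{r+1}(F_n)$, where $F_n$ is the free group of rank $n$ and $\gamma_k$ denotes the $k$-th term of the lower central series ($\gamma_1(F_n)=F_n$). $\langle\langle\cdot\rangle\rangle$ denotes normal closure. *)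

theory Defs
  imports "HOL-Algebra.Generated_Groups" "HOL-Library.Extended_Nat"
begin

section \<open>Words and free groups\<close>

text \<open>A letter \<open>(x, True)\<close> stands for \<open>x\<close> and \<open>(x, False)\<close> for its formal inverse.\<close>

type_synonym 'a letter = "'a \<times> bool"

definition inv_letter :: "'a letter \<Rightarrow> 'a letter" where
  "inv_letter a = (fst a, \<not> snd a)"

definition reduced :: "'a letter list \<Rightarrow> bool" where
  "reduced w \<longleftrightarrow> successively (\<lambda>a b. b \<noteq> inv_letter a) w"

fun cancel_Cons :: "'a letter \<Rightarrow> 'a letter list \<Rightarrow> 'a letter list" where
  "cancel_Cons a [] = [a]"
| "cancel_Cons a (b # w) = (if b = inv_letter a then w else a # b # w)"

definition free_reduce :: "'a letter list \<Rightarrow> 'a letter list" where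
  "free_reduce w = foldr cancel_Cons w []"

definition free_group :: "'a set \<Rightarrow> 'a letter list monoid" where
  "free_group A = \<lparr>carrier = {w. set w \<subseteq> A \<times> UNIV \<and> reduced w},
                   mult = (\<lambda>u v. free_reduce (u @ v)),
                   one = []\<rparr>"

lemma inv_letter_inv_letter [simp]: "inv_letter (inv_letter a) = a"
  by (simp add: inv_letter_def)

lemma reduced_Nil [simp]: "reduced []"
  by (simp add: reduced_def)

lemma reduced_ConsD: "reduced (a # w) \<Longrightarrow> reduced w"
  by (cases w) (auto simp: reduced_def)

lemma reduced_cancel_Cons: "reduced w \<Longrightarrow> reduced (cancel_Cons a w)"
  by (cases w) (auto simp: reduced_def intro: reduced_ConsD[unfolded reduced_def])

lemma reduced_foldr: "reduced w \<Longrightarrow> reduced (foldr cancel_Cons u w)"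
  by (induction u) (auto intro: reduced_cancel_Cons)

lemma set_cancel_Cons: "set (cancel_Cons a w) \<subseteq> insert a (set w)"
  by (cases w) auto

lemma set_foldr: "set (foldr cancel_Cons u w) \<subseteq> set u \<union> set w"
  using set_cancel_Cons by (induction u) fastforce+

lemma free_reduce_reduced: "reduced w \<Longrightarrow> free_reduce w = w"
proof (induction w)
  case (Cons a w)
  then have "foldr cancel_Cons w [] = w"
    using reduced_ConsD unfolding free_reduce_def by blast
  with Cons.prems show ?case
    by (cases w) (auto simp: free_reduce_def reduced_def)
qed (simp add: free_reduce_def)

lemma cancel_Cons_inverse:
  "reduced w \<Longrightarrow> cancel_Cons a (cancel_Cons (inv_letter a) w) = w"
proof (cases w)
  case (Cons b v)
  assume "reduced w"
  with Cons show ?thesis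
    by (cases v) (auto simp: reduced_def)
qed simp

lemma foldr_cancel_Cons:
  assumes "reduced w"
  shows "foldr cancel_Cons (cancel_Cons a u) w = cancel_Cons a (foldr cancel_Cons u w)"
proof (cases u)
  case (Cons b v)
  then show ?thesis
    using cancel_Cons_inverse[OF reduced_foldr[OF assms, of v], of a] by auto
qed simp

lemma foldr_free_reduce:
  "reduced w \<Longrightarrow> foldr cancel_Cons (free_reduce u) w = foldr cancel_Cons u w"
  by (induction u) (simp_all add: free_reduce_def foldr_cancel_Cons)

lemma free_reduce_append:
  "reduced v \<Longrightarrow> free_reduce (u @ v) = foldr cancel_Cons u v"
  using free_reduce_reduced[of v] by (simp add: free_reduce_def)

lemma free_reduce_rev_inv:
  "free_reduce (map inv_letter (rev w) @ w) = []"
proof (induction w)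
  case (Cons a w)
  have r: "reduced (foldr cancel_Cons w [])"
    by (simp add: reduced_foldr)
  show ?case
    using Cons cancel_Cons_inverse[OF r, of "inv_letter a"]
    by (simp add: free_reduce_def)
qed (simp add: free_reduce_def)

lemma reduced_rev_inv:
  "reduced w \<Longrightarrow> reduced (map inv_letter (rev w))"
  unfolding reduced_def successively_map successively_rev
  by (erule successively_mono) (metis inv_letter_inv_letter)

lemma group_free_group: "group (free_group A)"
proof (rule groupI)
  show "\<exists>y\<in>carrier (free_group A). y \<otimes>\<^bsub>free_group A\<^esub> x = \<one>\<^bsub>free_group A\<^esub>"
    if "x \<in> carrier (free_group A)" for x
  proof (rule bexI)
    show "map inv_letter (rev x) \<otimes>\<^bsub>free_group A\<^esub> x = \<one>\<^bsub>free_group A\<^esub>"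
      by (simp add: free_group_def free_reduce_rev_inv)
    show "map inv_letter (rev x) \<in> carrier (free_group A)"
      using that by (auto simp: free_group_def reduced_rev_inv inv_letter_def)
  qed
next
  fix x y
  assume "x \<in> carrier (free_group A)" "y \<in> carrier (free_group A)"
  then show "x \<otimes>\<^bsub>free_group A\<^esub> y \<in> carrier (free_group A)"
    using set_foldr[of x y]
    by (auto simp: free_group_def free_reduce_append reduced_foldr)
next
  fix x y z
  assume "x \<in> carrier (free_group A)" "y \<in> carrier (free_group A)" "z \<in> carrier (free_group A)"
  then show "x \<otimes>\<^bsub>free_group A\<^esub> y \<otimes>\<^bsub>free_group A\<^esub> z
      = x \<otimes>\<^bsub>free_group A\<^esub> (y \<otimes>\<^bsub>free_group A\<^esub> z)"
    using foldr_free_reduce[of z "x @ y"]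
    by (simp add: free_group_def free_reduce_append reduced_foldr)
qed (simp_all add: free_group_def free_reduce_reduced)


section \<open>Lower central series and normal closure\<close>

text \<open>\<open>\<gamma>\<^sub>1 G = G\<close>, \<open>\<gamma>\<^sub>k\<^sub>+\<^sub>1 G = [\<gamma>\<^sub>k G, G]\<close>.  The series is indexed
  from 1; the value at 0 is a dummy.  Commutators are \<open>h g h\<inverse> g\<inverse>\<close>, as in \<^const>\<open>derived\<close>.\<close>

fun lower_central :: "('a, 'b) monoid_scheme \<Rightarrow> nat \<Rightarrow> 'a set" where
  "lower_central G 0 = carrier G"
| "lower_central G (Suc 0) = carrier G"
| "lower_central G (Suc (Suc k)) = generate G
     (\<Union>h \<in> lower_central G (Suc k). \<Union>g \<in> carrier G.
        {h \<otimes>\<^bsub>G\<^esub> g \<otimes>\<^bsub>G\<^esub> (inv\<^bsub>G\<^esub> h) \<otimes>\<^bsub>G\<^esub> (inv\<^bsub>G\<^esub> g)})"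

definition normal_closure :: "('a, 'b) monoid_scheme \<Rightarrow> 'a set \<Rightarrow> 'a set" where
  "normal_closure G S = \<Inter>{N. N \<lhd> G \<and> S \<subseteq> N}"

context group
begin

lemma normal_carrier: "carrier G \<lhd> G"
  by (simp add: normal_inv_iff subgroup_self)

lemma normal_lower_central: "lower_central G k \<lhd> G"
proof (induction k)
  case (Suc k)
  show ?case
  proof (cases k)
    case (Suc j)
    let ?C = "\<Union>h \<in> lower_central G k. \<Union>g \<in> carrier G. {h \<otimes> g \<otimes> inv h \<otimes> inv g}"
    have sub: "lower_central G k \<subseteq> carrier G"
      using Suc.IH normal_imp_subgroup subgroup.subset by blast
    have "generate G ?C \<lhd> G"
    proof (rule normal_generateI)
      show "?C \<subseteq> carrier G"
        using sub by auto
      fix c x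
      assume "c \<in> ?C" and x: "x \<in> carrier G"
      then obtain h g where hg: "h \<in> lower_central G k" "g \<in> carrier G"
        and c: "c = h \<otimes> g \<otimes> inv h \<otimes> inv g"
        by auto
      have h: "h \<in> carrier G"
        using hg sub by auto
      have canc: "inv x \<otimes> (x \<otimes> y) = y" if "y \<in> carrier G" for y
        using x that by (simp flip: m_assoc)
      have "x \<otimes> c \<otimes> inv x =
          (x \<otimes> h \<otimes> inv x) \<otimes> (x \<otimes> g \<otimes> inv x) \<otimes> inv (x \<otimes> h \<otimes> inv x) \<otimes> inv (x \<otimes> g \<otimes> inv x)"
        using x h hg by (simp add: c inv_mult_group m_assoc canc)
      moreover have "x \<otimes> h \<otimes> inv x \<in> lower_central G k"
        using Suc.IH hg x by (simp add: normal_inv_iff)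
      ultimately show "x \<otimes> c \<otimes> inv x \<in> ?C"
        using x hg by auto
    qed
    with Suc show ?thesis
      by simp
  qed (simp add: normal_carrier)
qed (simp add: normal_carrier)

lemma normal_closure_normal:
  assumes "S \<subseteq> carrier G"
  shows "normal_closure G S \<lhd> G"
proof -
  have "subgroup (normal_closure G S) G"
    unfolding normal_closure_def
    using assms normal_carrier by (intro subgroups_Inter) (auto intro: normal_imp_subgroup)
  then show ?thesis
    by (auto simp: normal_inv_iff normal_closure_def)
qed

lemma normal_closure_superset: "S \<subseteq> normal_closure G S"
  by (auto simp: normal_closure_def)

end


section \<open>Palindromic width\<close>

definition word_value :: "('a, 'b) monoid_scheme \<Rightarrow> 'a letter list \<Rightarrow> 'a" where
  "word_value G w =
     foldr (\<otimes>\<^bsub>G\<^esub>) (map (\<lambda>(s, e). if e then s else inv\<^bsub>G\<^esub> s) w) \<one>\<^bsub>G\<^esub>"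

text \<open>Words are formal: even if \<open>s = s\<inverse>\<close> holds in \<open>G\<close>, the letters
  \<open>(s, True)\<close> and \<open>(s, False)\<close> are different, and \<open>s s\<close> is reduced.\<close>

definition palindromic_word :: "'a set \<Rightarrow> 'a letter list \<Rightarrow> bool" where
  "palindromic_word S w \<longleftrightarrow> set w \<subseteq> S \<times> UNIV \<and> reduced w \<and> rev w = w"

definition palindromes :: "('a, 'b) monoid_scheme \<Rightarrow> 'a set \<Rightarrow> 'a set" where
  "palindromes G S = {word_value G w | w. palindromic_word S w}"

text \<open>The values lie in \<^typ>\<open>enat\<close>: the length of an element that is not a product of
  palindromes, and an unbounded width, are \<open>\<infinity>\<close>.\<close>

definition palindromic_length :: "('a, 'b) monoid_scheme \<Rightarrow> 'a set \<Rightarrow> 'a \<Rightarrow> enat" where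
  "palindromic_length G S g =
     Inf {enat (length ps) | ps. set ps \<subseteq> palindromes G S \<and> foldr (\<otimes>\<^bsub>G\<^esub>) ps \<one>\<^bsub>G\<^esub> = g}"

definition palindromic_width :: "('a, 'b) monoid_scheme \<Rightarrow> 'a set \<Rightarrow> enat" where
  "palindromic_width G S = (SUP g \<in> carrier G. palindromic_length G S g)"


section \<open>The groups \<open>N\<^sub>n\<^sub>,\<^sub>r\<close> and their quotients by the squares of the basis\<close>

abbreviation free_group_rank :: "nat \<Rightarrow> nat letter list monoid" where
  "free_group_rank n \<equiv> free_group {1..n}"

definition free_nilpotent :: "nat \<Rightarrow> nat \<Rightarrow> nat letter list set monoid" where
  "free_nilpotent n r = free_group_rank n Mod lower_central (free_group_rank n) (r + 1)"

definition free_nilpotent_gen :: "nat \<Rightarrow> nat \<Rightarrow> nat \<Rightarrow> nat letter list set" where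
  "free_nilpotent_gen n r i = lower_central (free_group_rank n) (r + 1) #>\<^bsub>free_group_rank n\<^esub> [(i, True)]"

definition squares_closure :: "nat \<Rightarrow> nat \<Rightarrow> nat letter list set set" where
  "squares_closure n r =
     normal_closure (free_nilpotent n r)
       ((\<lambda>i. free_nilpotent_gen n r i [^]\<^bsub>free_nilpotent n r\<^esub> (2::nat)) ` {1..n})"

definition free_nilpotent_tilde :: "nat \<Rightarrow> nat \<Rightarrow> nat letter list set set monoid" where
  "free_nilpotent_tilde n r = free_nilpotent n r Mod squares_closure n r"

definition free_nilpotent_tilde_gens :: "nat \<Rightarrow> nat \<Rightarrow> nat letter list set set set" where
  "free_nilpotent_tilde_gens n r =
     (\<lambda>i. squares_closure n r #>\<^bsub>free_nilpotent n r\<^esub> free_nilpotent_gen n r i) ` {1..n}"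

end

theory Submission
  imports Defs
begin

text \<open>The generators \<open>y\<^sub>i\<close> are involutions, so a palindrome \<open>w a w\<^sup>R\<close> of odd length is a conjugate
  of a generator, one of even length is trivial, and every conjugate \<open>g y\<^sub>i g\<inverse>\<close> arises.  The
  palindromic length is therefore the length with respect to the conjugates of the generators
  (\<open>palindromes_involutions\<close>), and both bounds are statements about products of such conjugates.

  Upper bounds.  Modulo \<open>\<gamma>\<^sub>2\<close> an element \<open>g\<close> is a product of distinct generators.  Write this product
  with one factor for each index \<open>i\<close>: the generator \<open>y\<^sub>i\<close> if it occurs, and \<open>y\<^sub>i y\<^sub>i = 1\<close> if it does
  not.  Conjugating the last letter of the \<open>i\<close>-th factor by \<open>h\<^sub>i \<in> \<gamma>\<^sub>k\<close> changes the product, modulo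
  \<open>\<gamma>\<^sub>k\<^sub>+\<^sub>2\<close>, by the product of the central elements \<open>[h\<^sub>i, y\<^sub>i]\<close>.  These products fill all
  of \<open>\<gamma>\<^sub>k\<^sub>+\<^sub>1\<close> modulo \<open>\<gamma>\<^sub>k\<^sub>+\<^sub>2\<close>, because the commutator is bimultiplicative there
  (\<open>generate_commutators_subset\<close>).  An approximation of \<open>g\<close> modulo \<open>\<gamma>\<^sub>k\<^sub>+\<^sub>1\<close> thus improves to one
  modulo \<open>\<gamma>\<^sub>k\<^sub>+\<^sub>2\<close> (\<open>refine_approximation\<close>), and nilpotency makes the last one exact, with at most
  two palindromes for each index.  In class two one index \<open>k\<close> can be dispensed with, since
  \<open>[y\<^sub>j, y\<^sub>k] = [y\<^sub>k, y\<^sub>j]\<inverse>\<close> is already supplied by the index \<open>j\<close>.  If some generator is missing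
  from \<open>g\<close> modulo \<open>\<gamma>\<^sub>2\<close>, omit its index; if none is missing, \<open>n\<close> palindromes suffice.  In
  both cases the length is at most \<open>2(n - 1)\<close>.

  Lower bounds.  The number \<open>2(n - 1)\<close> is a lower bound in every class \<open>r \<ge> 2\<close>, and it is at least
  \<open>n\<close>.  For \<open>i \<noteq> j\<close> there is a homomorphism onto the group of unitriangular \<open>3 \<times> 3\<close> matrices over the
  field with two elements that sends \<open>y\<^sub>i\<close> and \<open>y\<^sub>j\<close> to the two standard generators and kills the other
  \<open>y\<^sub>m\<close>.  The element \<open>(y\<^sub>1 \<cdots> y\<^sub>n)\<^sup>2\<close> has the nontrivial central element as its image for every
  such pair.  Hence in any factorisation into conjugates of generators each index occurs an even number of
  times, and of two distinct indices at least one occurs; so at least \<open>n - 1\<close> indices occur at least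
  twice (\<open>palindromic_width_ge\<close>).\<close>

section \<open>Products of lists in a group\<close>

abbreviation list_prod :: "('a, 'b) monoid_scheme \<Rightarrow> 'a list \<Rightarrow> 'a" where
  "list_prod G xs \<equiv> foldr (\<otimes>\<^bsub>G\<^esub>) xs \<one>\<^bsub>G\<^esub>"

definition commutator :: "('a, 'b) monoid_scheme \<Rightarrow> 'a \<Rightarrow> 'a \<Rightarrow> 'a" where
  "commutator G h g = h \<otimes>\<^bsub>G\<^esub> g \<otimes>\<^bsub>G\<^esub> (inv\<^bsub>G\<^esub> h) \<otimes>\<^bsub>G\<^esub> (inv\<^bsub>G\<^esub> g)"

lemma lower_central_Suc_Suc:
  "lower_central G (Suc (Suc k)) =
     generate G {commutator G h g | h g. h \<in> lower_central G (Suc k) \<and> g \<in> carrier G}"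
  unfolding lower_central.simps commutator_def by (rule arg_cong[of _ _ "generate G"]) blast

context group
begin

lemma inv_cancel_left:
  assumes "x \<in> carrier G" "y \<in> carrier G"
  shows "inv x \<otimes> (x \<otimes> y) = y" "x \<otimes> (inv x \<otimes> y) = y"
  using assms by (simp_all flip: m_assoc)

lemma list_prod_closed: "set xs \<subseteq> carrier G \<Longrightarrow> list_prod G xs \<in> carrier G"
  by (induction xs) auto

lemma list_prod_append:
  "set xs \<subseteq> carrier G \<Longrightarrow> set ys \<subseteq> carrier G \<Longrightarrow>
     list_prod G (xs @ ys) = list_prod G xs \<otimes> list_prod G ys"
  by (induction xs) (auto simp: m_assoc list_prod_closed simp del: foldr_append)

lemma list_prod_concat:
  "(\<And>xs. xs \<in> set xss \<Longrightarrow> set xs \<subseteq> carrier G) \<Longrightarrow>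
     list_prod G (concat xss) = list_prod G (map (list_prod G) xss)"
  by (induction xss) (auto simp: list_prod_append UN_subset_iff simp del: foldr_append)

lemma list_prod_commute:
  assumes "\<And>c. c \<in> set cs \<Longrightarrow> c \<in> carrier G \<and> c \<otimes> x = x \<otimes> c" "x \<in> carrier G"
  shows "list_prod G cs \<otimes> x = x \<otimes> list_prod G cs"
  using assms(1)
proof (induction cs)
  case (Cons c cs)
  then have c: "c \<in> carrier G" "c \<otimes> x = x \<otimes> c"
    and cs: "list_prod G cs \<in> carrier G" "list_prod G cs \<otimes> x = x \<otimes> list_prod G cs"
    by (auto intro!: list_prod_closed)
  have "list_prod G (c # cs) \<otimes> x = c \<otimes> (x \<otimes> list_prod G cs)"
    using c cs assms(2) by (simp add: m_assoc)
  also have "\<dots> = x \<otimes> list_prod G (c # cs)"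
    using c cs assms(2) by (simp flip: m_assoc)
  finally show ?case .
qed (use assms(2) in simp)

text \<open>Two products over the same index list can be merged factor by factor when one of them consists of
  central elements.  The successive corrections are applied in this way.\<close>

lemma list_prod_mult_central:
  assumes "\<And>i. i \<in> set xs \<Longrightarrow> c i \<in> carrier G" "\<And>i. i \<in> set xs \<Longrightarrow> u i \<in> carrier G"
    and "\<And>i x. i \<in> set xs \<Longrightarrow> x \<in> carrier G \<Longrightarrow> c i \<otimes> x = x \<otimes> c i"
  shows "list_prod G (map (\<lambda>i. c i \<otimes> u i) xs) =
    list_prod G (map c xs) \<otimes> list_prod G (map u xs)"
  using assms
proof (induction xs)
  case (Cons i xs)
  define C U where "C = list_prod G (map c xs)" and "U = list_prod G (map u xs)"
  have cl: "C \<in> carrier G" "U \<in> carrier G" "c i \<in> carrier G" "u i \<in> carrier G"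
    using Cons.prems by (auto simp: C_def U_def simp del: foldr_map intro!: list_prod_closed)
  have comm: "C \<otimes> u i = u i \<otimes> C"
    using Cons.prems unfolding C_def by (intro list_prod_commute) auto
  have "c i \<otimes> u i \<otimes> (C \<otimes> U) = c i \<otimes> (u i \<otimes> C) \<otimes> U"
    using cl by (simp add: m_assoc)
  also have "\<dots> = c i \<otimes> C \<otimes> (u i \<otimes> U)"
    using cl by (simp add: m_assoc flip: comm)
  finally show ?case
    using Cons by (simp add: C_def U_def)
qed simp

lemma list_prod_single:
  "distinct xs \<Longrightarrow> a \<in> carrier G \<Longrightarrow>
     list_prod G (map (\<lambda>j. if j = i then a else \<one>) xs) = (if i \<in> set xs then a else \<one>)"
  by (induction xs) auto

lemma list_prod_filter:
  "(\<And>i. i \<in> set xs \<Longrightarrow> \<not> P i \<Longrightarrow> u i = \<one>) \<Longrightarrow> u ` set xs \<subseteq> carrier G \<Longrightarrow>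
     list_prod G (map u (filter P xs)) = list_prod G (map u xs)"
proof (induction xs)
  case (Cons i xs)
  moreover have "list_prod G (map u xs) \<in> carrier G"
    using Cons.prems by (intro list_prod_closed) auto
  ultimately show ?case by auto
qed simp

lemma generate_involutions:
  assumes S: "S \<subseteq> carrier G" "\<And>s. s \<in> S \<Longrightarrow> s \<otimes> s = \<one>" and g: "g \<in> generate G S"
  shows "\<exists>ws. set ws \<subseteq> S \<and> g = list_prod G ws"
  using g
proof (induction g rule: generate.induct)
  case one
  show ?case by (intro exI[of _ "[]"]) simp
next
  case (incl s)
  then show ?case using S by (intro exI[of _ "[s]"]) auto
next
  case (inv s)
  then have "inv s = s" using S by (metis inv_equality subsetD)
  then show ?case using inv S by (intro exI[of _ "[s]"]) auto
next
  case (eng a b)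
  then obtain us vs where "set us \<subseteq> S" "a = list_prod G us" "set vs \<subseteq> S" "b = list_prod G vs"
    by blast
  then show ?case
    using S by (intro exI[of _ "us @ vs"]) (auto simp: list_prod_append simp del: foldr_append)
qed

end

lemma (in group_hom) hom_list_prod:
  "set xs \<subseteq> carrier G \<Longrightarrow> h (list_prod G xs) = list_prod H (map h xs)"
  by (induction xs) (auto simp: G.list_prod_closed)

lemma (in group_hom) hom_commutator:
  "x \<in> carrier G \<Longrightarrow> y \<in> carrier G \<Longrightarrow>
     h (commutator G x y) = commutator H (h x) (h y)"
  by (simp add: commutator_def)


section \<open>Palindromes over involutions\<close>

context group
begin

lemma list_prod_rev_involutions:
  assumes "set ws \<subseteq> carrier G" "\<And>s. s \<in> set ws \<Longrightarrow> s \<otimes> s = \<one>"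
  shows "list_prod G (rev ws) = inv (list_prod G ws)"
  using assms
proof (induction ws)
  case (Cons s ws)
  then have "inv s = s" by (simp add: inv_equality)
  then show ?case
    using Cons
    by (simp add: list_prod_append list_prod_closed inv_mult_group del: foldr_append)
qed simp

text \<open>A palindrome over involutions is a conjugate of its middle letter, because the right half is the
  inverse of the left half; without a middle letter it cancels.  Conversely a conjugating element is the value
  of a word without inverse letters, and words of that kind are always reduced.\<close>

lemma palindromes_involutions:
  assumes S: "S \<subseteq> carrier G" "\<And>s. s \<in> S \<Longrightarrow> s \<otimes> s = \<one>"
  shows "palindromes G S = insert \<one> {g \<otimes> s \<otimes> inv g | g s. g \<in> generate G S \<and> s \<in> S}"
proof -
  have inv_S: "inv s = s" if "s \<in> S" for s
    using that S by (metis inv_equality subsetD)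
  have val: "word_value G w = list_prod G (map fst w)" if "set w \<subseteq> S \<times> UNIV" for w
  proof -
    have "map (\<lambda>(s, e). if e then s else inv s) w = map fst w"
      using that inv_S by (intro map_cong) auto
    then show ?thesis by (simp only: word_value_def)
  qed
  have "list_prod G us = \<one> \<or> (\<exists>g\<in>generate G S. \<exists>s\<in>S. list_prod G us = g \<otimes> s \<otimes> inv g)"
    if "set us \<subseteq> S" "rev us = us" for us
    using that
  proof (induction "length us" arbitrary: us rule: less_induct)
    case less
    show ?case
    proof (cases us)
      case (Cons a vs)
      show ?thesis
      proof (cases vs rule: rev_cases)
        case Nil
        then have "list_prod G us = \<one> \<otimes> a \<otimes> inv \<one>" "a \<in> S"
          using Cons S less.prems by auto
        then show ?thesis
          using generate.one[of G S] by blast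
      next
        case (snoc ts b)
        have "b # rev ts @ [a] = a # ts @ [b]"
          using less.prems(2) by (simp only: Cons snoc rev.simps rev_append append.simps)
        then have ba: "b = a" and ts: "rev ts = ts"
          by (blast dest: list.inject[THEN iffD1] append1_eq_conv[THEN iffD1])+
        have set_ts: "set ts \<subseteq> S" and aS: "a \<in> S"
          using less.prems(1) by (simp_all add: Cons snoc)
        have us: "us = a # ts @ [a]" and len: "length ts < length us"
          by (simp_all add: Cons snoc ba)
        have a: "a \<in> carrier G" "inv a = a" "a \<otimes> a = \<one>"
          using S aS inv_S by auto
        have prod: "list_prod G us = a \<otimes> list_prod G ts \<otimes> inv a"
          using set_ts S a list_prod_closed[of ts]
          by (auto simp: us list_prod_append m_assoc simp del: foldr_append)
        consider "list_prod G ts = \<one>"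
          | g s where "g \<in> generate G S" "s \<in> S" "list_prod G ts = g \<otimes> s \<otimes> inv g"
          using less.hyps[OF _ set_ts ts] len by blast
        then show ?thesis
        proof cases
          case 1
          then show ?thesis using prod a by simp
        next
          case 2
          then have gs: "g \<in> carrier G" "s \<in> carrier G"
            using S generate_in_carrier by blast+
          have "list_prod G us = (a \<otimes> g) \<otimes> s \<otimes> inv (a \<otimes> g)"
            unfolding prod 2(3) using gs a(1) by (simp add: m_assoc inv_mult_group)
          moreover have "a \<otimes> g \<in> generate G S"
            using 2 aS by (blast intro: generate.eng generate.incl)
          ultimately show ?thesis using 2 by blast
        qed
      qed
    qed simp
  qed
  note value_palindrome = this
  have "p \<in> insert \<one> {g \<otimes> s \<otimes> inv g | g s. g \<in> generate G S \<and> s \<in> S}"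
    if "p \<in> palindromes G S" for p
  proof -
    obtain w where w: "p = word_value G w" "set w \<subseteq> S \<times> UNIV" "rev w = w"
      using \<open>p \<in> palindromes G S\<close> by (auto simp: palindromes_def palindromic_word_def)
    have "rev (map fst w) = map fst w" "set (map fst w) \<subseteq> S"
      using w(2,3) by (auto simp: rev_map)
    then show ?thesis
      using value_palindrome[of "map fst w"] unfolding w(1) val[OF w(2)] by blast
  qed
  moreover have positive: "list_prod G us \<in> palindromes G S"
    if "set us \<subseteq> S" "rev us = us" for us
  proof -
    let ?w = "map (\<lambda>s. (s, True)) us"
    have "reduced ?w"
      by (simp add: reduced_def successively_map inv_letter_def successively_conv_nth)
    moreover have "rev ?w = ?w" using that by (simp add: rev_map)
    ultimately have "palindromic_word S ?w"
      using that by (auto simp: palindromic_word_def)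
    moreover have "word_value G ?w = list_prod G us"
      by (simp add: word_value_def comp_def)
    ultimately show ?thesis
      unfolding palindromes_def by (intro CollectI exI[of _ ?w]) simp
  qed
  moreover have "g \<otimes> s \<otimes> inv g \<in> palindromes G S" if g: "g \<in> generate G S" and s: "s \<in> S" for g s
  proof -
    obtain ws where ws: "set ws \<subseteq> S" "g = list_prod G ws"
      using generate_involutions[OF S g] by blast
    have wsG: "set ws \<subseteq> carrier G" and sG: "s \<in> carrier G" using ws s S by auto
    have "list_prod G (rev ws) = inv g"
      unfolding ws(2) using ws S by (intro list_prod_rev_involutions) auto
    then have "list_prod G (ws @ [s] @ rev ws) = g \<otimes> s \<otimes> inv g"
      using wsG sG list_prod_closed[OF wsG]
      by (simp add: list_prod_append ws(2) m_assoc del: foldr_append)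
    then show ?thesis
      using positive[of "ws @ [s] @ rev ws"] ws s by auto
  qed
  moreover have "\<one> \<in> palindromes G S"
    using positive[of "[]"] by simp
  ultimately show ?thesis by blast
qed

end


section \<open>Products of central commutators\<close>

lemma (in group) commutator_closed:
  "h \<in> carrier G \<Longrightarrow> g \<in> carrier G \<Longrightarrow> commutator G h g \<in> carrier G"
  by (simp add: commutator_def)

text \<open>The identity \<open>[ab, g] = a [b, g] a\<inverse> [a, g]\<close> loses its conjugation when \<open>[b, g]\<close> is central, and
  dually in the second argument.\<close>

lemma (in group) commutator_mult_left:
  assumes "a \<in> carrier G" "b \<in> carrier G" "g \<in> carrier G"
    and central: "\<And>x. x \<in> carrier G \<Longrightarrow> commutator G b g \<otimes> x = x \<otimes> commutator G b g"
  shows "commutator G (a \<otimes> b) g = commutator G a g \<otimes> commutator G b g"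
proof -
  have "commutator G (a \<otimes> b) g = (a \<otimes> commutator G b g) \<otimes> (g \<otimes> inv a \<otimes> inv g)"
    using assms(1-3) by (simp add: commutator_def m_assoc inv_mult_group inv_cancel_left)
  also have "\<dots> = commutator G b g \<otimes> commutator G a g"
    using assms(1-3) by (simp add: commutator_closed m_assoc flip: central)
      (simp add: commutator_def m_assoc)
  finally show ?thesis
    using assms(1-3) by (simp add: central commutator_closed)
qed

lemma (in group) commutator_mult_right:
  assumes "h \<in> carrier G" "a \<in> carrier G" "b \<in> carrier G"
    and central: "\<And>x. x \<in> carrier G \<Longrightarrow> commutator G h b \<otimes> x = x \<otimes> commutator G h b"
  shows "commutator G h (a \<otimes> b) = commutator G h a \<otimes> commutator G h b"
proof -
  have "commutator G h (a \<otimes> b) = commutator G h a \<otimes> (a \<otimes> commutator G h b \<otimes> inv a)"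
    using assms(1-3) by (simp add: commutator_def m_assoc inv_mult_group inv_cancel_left)
  also have "a \<otimes> commutator G h b \<otimes> inv a = commutator G h b"
    using assms(1-3) by (simp add: commutator_closed m_assoc flip: central)
  finally show ?thesis .
qed

lemma (in group) commutator_swap:
  "h \<in> carrier G \<Longrightarrow> g \<in> carrier G \<Longrightarrow> commutator G h g = inv (commutator G g h)"
  by (simp add: commutator_def m_assoc inv_mult_group)

text \<open>The situation in the quotient by \<open>\<gamma>\<^sub>k\<^sub>+\<^sub>2\<close>, where \<open>L\<close> is the image of \<open>\<gamma>\<^sub>k\<close>.\<close>

locale central_commutators = group G for G (structure) +
  fixes L :: "'a set" and y :: "'i \<Rightarrow> 'a" and xs :: "'i list"
  assumes L: "subgroup L G"
    and central: "\<And>h g x. h \<in> L \<Longrightarrow> g \<in> carrier G \<Longrightarrow> x \<in> carrier G \<Longrightarrow>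
      commutator G h g \<otimes> x = x \<otimes> commutator G h g"
    and y: "\<And>i. i \<in> set xs \<Longrightarrow> y i \<in> carrier G"
    and distinct: "distinct xs"
begin

definition products :: "'a set" where
  "products = {list_prod G (map (\<lambda>i. commutator G (h i) (y i)) xs) | h. \<forall>i. h i \<in> L}"

lemma L_carrier: "h \<in> L \<Longrightarrow> h \<in> carrier G"
  using L subgroup.mem_carrier by metis

lemma products_closed: "products \<subseteq> carrier G"
  unfolding products_def
  by (clarify, rule list_prod_closed) (auto intro: commutator_closed L_carrier y)

text \<open>By bimultiplicativity and centrality the product for the exponents \<open>h i \<otimes> k i\<close> is the product of the
  two given ones.\<close>

lemma products_mult:
  assumes "a \<in> products" "b \<in> products"
  shows "a \<otimes> b \<in> products"
proof -
  obtain h k where h: "\<forall>i. h i \<in> L" "a = list_prod G (map (\<lambda>i. commutator G (h i) (y i)) xs)"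
    and k: "\<forall>i. k i \<in> L" "b = list_prod G (map (\<lambda>i. commutator G (k i) (y i)) xs)"
    using assms unfolding products_def by blast
  have "list_prod G (map (\<lambda>i. commutator G (h i \<otimes> k i) (y i)) xs) =
      list_prod G (map (\<lambda>i. commutator G (h i) (y i) \<otimes> commutator G (k i) (y i)) xs)"
    using h k y by (intro arg_cong[where f = "list_prod G"] map_cong refl commutator_mult_left)
      (auto intro: L_carrier central)
  also have "\<dots> = a \<otimes> b"
    unfolding h(2) k(2) using h k y
    by (intro list_prod_mult_central) (auto intro: L_carrier central commutator_closed)
  finally have "a \<otimes> b = list_prod G (map (\<lambda>i. commutator G (h i \<otimes> k i) (y i)) xs)" by simp
  moreover have "\<forall>i. h i \<otimes> k i \<in> L"
    using h k L by (simp add: subgroup.m_closed)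
  ultimately show ?thesis
    unfolding products_def by (intro CollectI exI[of _ "\<lambda>i. h i \<otimes> k i"]) simp
qed

lemma commutator_one: "g \<in> carrier G \<Longrightarrow> commutator G \<one> g = \<one>" "g \<in> carrier G \<Longrightarrow> commutator G g \<one> = \<one>"
  by (simp_all add: commutator_def)

lemma one_products: "\<one> \<in> products"
proof -
  have "map (\<lambda>i. commutator G \<one> (y i)) xs = map (\<lambda>i. \<one>) xs"
    using y by (intro map_cong) (auto simp: commutator_one)
  then have "list_prod G (map (\<lambda>i. commutator G \<one> (y i)) xs) = list_prod G (map (\<lambda>i. \<one>) xs)"
    by (simp only:)
  also have "\<dots> = \<one>" by (induction xs) auto
  finally show ?thesis
    using subgroup.one_closed[OF L] unfolding products_def
    by (intro CollectI exI[of _ "\<lambda>i. \<one>"]) simp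
qed

lemma commutator_in_products:
  assumes "i \<in> set xs" "h \<in> L"
  shows "commutator G h (y i) \<in> products"
proof -
  let ?h = "\<lambda>j. if j = i then h else \<one>"
  have "map (\<lambda>j. commutator G (?h j) (y j)) xs =
      map (\<lambda>j. if j = i then commutator G h (y i) else \<one>) xs"
    using y by (intro map_cong) (auto simp: commutator_one)
  then have "list_prod G (map (\<lambda>j. commutator G (?h j) (y j)) xs) = commutator G h (y i)"
    using list_prod_single[OF distinct, of "commutator G h (y i)" i] assms y
    by (simp only:) (simp add: commutator_closed L_carrier)
  moreover have "\<forall>j. ?h j \<in> L"
    using assms L by (simp add: subgroup.one_closed)
  ultimately show ?thesis
    unfolding products_def by (intro CollectI exI[of _ ?h]) simp
qed

lemma products_inv:
  assumes "a \<in> products"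
  shows "inv a \<in> products"
proof -
  obtain h where h: "\<forall>i. h i \<in> L" "a = list_prod G (map (\<lambda>i. commutator G (h i) (y i)) xs)"
    using assms unfolding products_def by blast
  have hk: "\<forall>i. inv (h i) \<in> L"
    using h L by (simp add: subgroup.m_inv_closed)
  define b where "b = list_prod G (map (\<lambda>i. commutator G (inv (h i)) (y i)) xs)"
  have b: "b \<in> products" unfolding products_def b_def using hk by auto
  have "b \<otimes> a = list_prod G (map (\<lambda>i. commutator G (inv (h i)) (y i) \<otimes> commutator G (h i) (y i)) xs)"
    unfolding h(2) b_def using h hk y
    by (intro list_prod_mult_central[symmetric]) (auto intro: L_carrier central commutator_closed)
  also have "map (\<lambda>i. commutator G (inv (h i)) (y i) \<otimes> commutator G (h i) (y i)) xs = map (\<lambda>i. \<one>) xs"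
  proof (intro map_cong refl)
    fix i assume "i \<in> set xs"
    then show "commutator G (inv (h i)) (y i) \<otimes> commutator G (h i) (y i) = \<one>"
      using h hk y commutator_mult_left[of "inv (h i)" "h i" "y i"]
      by (simp add: L_carrier central commutator_one)
  qed
  also have "list_prod G (map (\<lambda>i. \<one>) xs) = \<one>" by (induction xs) auto
  finally have "inv a = b"
    using products_closed assms b by (intro inv_equality) auto
  then show ?thesis using b by simp
qed

lemma subgroup_products: "subgroup products G"
  using products_closed one_products products_mult products_inv
  by (intro subgroupI) auto

lemma subgroup_left:
  assumes g: "g \<in> carrier G"
  shows "subgroup {h \<in> L. commutator G h g \<in> products} G"
proof (rule subgroupI)
  show "{h \<in> L. commutator G h g \<in> products} \<noteq> {}"
    using subgroup.one_closed[OF L] g one_products commutator_one by force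
  fix a assume "a \<in> {h \<in> L. commutator G h g \<in> products}"
  then have a: "a \<in> L" "commutator G a g \<in> products" by auto
  have ia: "inv a \<in> L" using a L subgroup.m_inv_closed by metis
  have "commutator G (inv a) g \<otimes> commutator G a g = \<one>"
    using commutator_mult_left[of "inv a" a g] a ia g by (simp add: L_carrier central commutator_one)
  then have "inv (commutator G a g) = commutator G (inv a) g"
    using a ia g by (intro inv_equality) (auto intro: commutator_closed L_carrier)
  then show "inv a \<in> {h \<in> L. commutator G h g \<in> products}"
    using ia products_inv[OF a(2)] by simp
next
  fix a b
  assume "a \<in> {h \<in> L. commutator G h g \<in> products}" "b \<in> {h \<in> L. commutator G h g \<in> products}"
  then show "a \<otimes> b \<in> {h \<in> L. commutator G h g \<in> products}"
    using g commutator_mult_left[of a b g] L subgroup.m_closed[OF L]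
    by (auto simp: L_carrier central products_mult)
qed (auto intro: L_carrier)

lemma subgroup_right:
  assumes h: "h \<in> L"
  shows "subgroup {g \<in> carrier G. commutator G h g \<in> products} G"
proof (rule subgroupI)
  show "{g \<in> carrier G. commutator G h g \<in> products} \<noteq> {}"
    using h one_products commutator_one L_carrier by force
  fix a assume "a \<in> {g \<in> carrier G. commutator G h g \<in> products}"
  then have a: "a \<in> carrier G" "commutator G h a \<in> products" by auto
  have "commutator G h (inv a) \<otimes> commutator G h a = \<one>"
    using commutator_mult_right[of h "inv a" a] a h by (simp add: L_carrier central commutator_one)
  then have "inv (commutator G h a) = commutator G h (inv a)"
    using a h by (intro inv_equality) (auto intro: commutator_closed L_carrier)
  then show "inv a \<in> {g \<in> carrier G. commutator G h g \<in> products}"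
    using a products_inv[OF a(2)] by simp
next
  fix a b
  assume "a \<in> {g \<in> carrier G. commutator G h g \<in> products}"
    "b \<in> {g \<in> carrier G. commutator G h g \<in> products}"
  then show "a \<otimes> b \<in> {g \<in> carrier G. commutator G h g \<in> products}"
    using h commutator_mult_right[of h a b]
    by (auto simp: L_carrier central products_mult)
qed auto

text \<open>All commutators of \<open>L\<close> with the group are products of commutators \<open>[h\<^sub>i, y\<^sub>i]\<close>: for fixed \<open>h\<close> the
  elements \<open>g\<close> with \<open>[h, g]\<close> of this form are a subgroup, which contains the generators.  If \<open>L\<close> is the
  whole group, one generator \<open>y\<^sub>k\<close> may be left out of the list: the elements \<open>h\<close> with \<open>[h, y\<^sub>k]\<close> of
  this form are a subgroup too, and it contains \<open>y\<^sub>k\<close> trivially and the other \<open>y\<^sub>j\<close> by antisymmetry.\<close>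

lemma generate_commutators_subset:
  assumes "insert k (set xs) = I" "generate G (y ` I) = carrier G" "y k \<in> carrier G"
    and k: "k \<in> set xs \<or> L = carrier G"
  shows "generate G {commutator G h g | h g. h \<in> L \<and> g \<in> carrier G} \<subseteq> products"
proof -
  have yk: "commutator G h (y k) \<in> products" if h: "h \<in> L" for h
  proof (cases "k \<in> set xs")
    case False
    then have L_all: "L = carrier G" using k by simp
    have "y i \<in> {h \<in> L. commutator G h (y k) \<in> products}" if "i \<in> I" for i
    proof (cases "i = k")
      case True
      have "commutator G (y k) (y k) = \<one>"
        using assms(3) by (simp add: commutator_def m_assoc)
      then show ?thesis using True L_all assms(3) one_products by simp
    next
      case False
      then have i: "i \<in> set xs" using that assms(1) by auto
      then have "commutator G (y i) (y k) = inv (commutator G (y k) (y i))"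
        using y assms(3) by (intro commutator_swap)
      then show ?thesis
        using i y L_all assms(3) commutator_in_products products_inv by simp
    qed
    then have "generate G (y ` I) \<subseteq> {h \<in> L. commutator G h (y k) \<in> products}"
      using subgroup_left assms(3) by (intro generate_subgroup_incl) auto
    then show ?thesis
      using assms(2) h L_carrier by auto
  qed (use h commutator_in_products in auto)
  have "commutator G h g \<in> products" if h: "h \<in> L" and g: "g \<in> carrier G" for h g
  proof -
    have "y ` I \<subseteq> {g \<in> carrier G. commutator G h g \<in> products}"
      using h yk commutator_in_products y assms(1,3) by auto
    then have "generate G (y ` I) \<subseteq> {g \<in> carrier G. commutator G h g \<in> products}"
      using subgroup_right[OF h] by (rule generate_subgroup_incl)
    then show ?thesis using assms(2) g by auto
  qed
  then show ?thesis
    using subgroup_products by (intro generate_subgroup_incl) auto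
qed

end


section \<open>Successive approximation along the lower central series\<close>

lemma (in group) lower_central_carrier: "x \<in> lower_central G k \<Longrightarrow> x \<in> carrier G"
  using normal_imp_subgroup[OF normal_lower_central] subgroup.mem_carrier by metis

lemma (in group) commutator_lower_central:
  "h \<in> lower_central G (Suc k) \<Longrightarrow> g \<in> carrier G \<Longrightarrow>
     commutator G h g \<in> lower_central G (Suc (Suc k))"
  unfolding lower_central_Suc_Suc by (rule generate.incl) blast

lemma (in group) commutator_eq_one_imp_commute:
  assumes "a \<in> carrier G" "b \<in> carrier G" "commutator G a b = \<one>"
  shows "a \<otimes> b = b \<otimes> a"
proof -
  have "a \<otimes> b = commutator G a b \<otimes> (b \<otimes> a)"
    using assms(1,2) by (simp add: commutator_def m_assoc inv_cancel_left)
  then show ?thesis using assms by simp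
qed

lemma (in group_hom) image_lower_central_Suc_Suc:
  "h ` lower_central G (Suc (Suc k)) = generate H
     {commutator H (h x) (h g) | x g. x \<in> lower_central G (Suc k) \<and> g \<in> carrier G}"
proof -
  let ?C = "{commutator G x g | x g. x \<in> lower_central G (Suc k) \<and> g \<in> carrier G}"
  have "?C \<subseteq> carrier G"
    by (auto intro: G.commutator_closed G.lower_central_carrier)
  then have "h ` lower_central G (Suc (Suc k)) = generate H (h ` ?C)"
    unfolding lower_central_Suc_Suc by (rule generate_img[symmetric])
  also have "h ` ?C = {commutator H (h x) (h g) | x g. x \<in> lower_central G (Suc k) \<and> g \<in> carrier G}"
    using hom_commutator G.lower_central_carrier by (auto simp: image_iff) metis+
  finally show ?thesis .
qed

lemma (in group_hom) lower_central_image_subset: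
  "h ` lower_central G k \<subseteq> lower_central H k"
proof (induction k rule: induct_nat_012)
  case (ge2 k)
  show ?case
    unfolding image_lower_central_Suc_Suc
  proof (rule H.generate_subgroup_incl)
    show "subgroup (lower_central H (Suc (Suc k))) H"
      using H.normal_lower_central by (rule normal_imp_subgroup)
    show "{commutator H (h x) (h g) | x g. x \<in> lower_central G (Suc k) \<and> g \<in> carrier G}
        \<subseteq> lower_central H (Suc (Suc k))"
    proof clarify
      fix x g assume "x \<in> lower_central G (Suc k)" "g \<in> carrier G"
      then show "commutator H (h x) (h g) \<in> lower_central H (Suc (Suc k))"
        using ge2(2) by (intro H.commutator_lower_central) auto
    qed
  qed
qed auto

lemma (in group_hom) lower_central_image:
  assumes "h ` carrier G = carrier H"
  shows "lower_central H k = h ` lower_central G k"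
proof (induction k rule: induct_nat_012)
  case (ge2 k)
  have "{commutator H (h x) (h g) | x g. x \<in> lower_central G (Suc k) \<and> g \<in> carrier G} =
      {commutator H x g | x g. x \<in> lower_central H (Suc k) \<and> g \<in> carrier H}"
    unfolding ge2 assms[symmetric] by blast
  then show ?case
    unfolding image_lower_central_Suc_Suc lower_central_Suc_Suc[of H] by (simp only:)
qed (simp_all add: assms)

lemma (in group) hom_to_quotient:
  assumes "N \<lhd> G"
  shows "group_hom G (G Mod N) (\<lambda>x. N #> x)" "(\<lambda>x. N #> x) ` carrier G = carrier (G Mod N)"
    and "x \<in> carrier G \<Longrightarrow> N #> x = \<one>\<^bsub>G Mod N\<^esub> \<longleftrightarrow> x \<in> N"
proof -
  interpret N: normal N G by fact
  show "group_hom G (G Mod N) (\<lambda>x. N #> x)"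
    using N.r_coset_hom_Mod N.factorgroup_is_group
    by (simp add: group_hom_def group_hom_axioms_def group_axioms)
  show "(\<lambda>x. N #> x) ` carrier G = carrier (G Mod N)"
    by (simp add: carrier_FactGroup)
  show "N #> x = \<one>\<^bsub>G Mod N\<^esub> \<longleftrightarrow> x \<in> N" if "x \<in> carrier G"
    using coset_join1[OF _ that N.subgroup_axioms] coset_join2[OF that N.subgroup_axioms]
    unfolding one_FactGroup by blast
qed

locale involution_generated = group G for G (structure) +
  fixes y :: "'i \<Rightarrow> 'a" and I :: "'i set"
  assumes y_carrier: "i \<in> I \<Longrightarrow> y i \<in> carrier G"
    and y_square: "i \<in> I \<Longrightarrow> y i \<otimes> y i = \<one>"
    and generate_y: "generate G (y ` I) = carrier G"
begin

lemma y_generate_involution: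
  assumes "g \<in> carrier G"
  obtains ws where "set ws \<subseteq> y ` I" "g = list_prod G ws"
proof -
  have "\<exists>ws. set ws \<subseteq> y ` I \<and> g = list_prod G ws"
    using y_carrier y_square assms generate_y by (intro generate_involutions) auto
  then show ?thesis using that by blast
qed

text \<open>The contribution of the index \<open>i\<close> to a factorisation.  If \<open>s i\<close> holds, it is one conjugate of
  \<open>y i\<close>; otherwise it is a product of two, which lies in the commutator subgroup.  The conjugator \<open>a i\<close> is the
  parameter that the refinement adjusts.\<close>

definition factor :: "('i \<Rightarrow> bool) \<Rightarrow> ('i \<Rightarrow> 'a) \<Rightarrow> 'i \<Rightarrow> 'a" where
  "factor s a i = (if s i then \<one> else y i) \<otimes> (a i \<otimes> y i \<otimes> inv (a i))"

lemma factor_closed: "i \<in> I \<Longrightarrow> a i \<in> carrier G \<Longrightarrow> factor s a i \<in> carrier G"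
  by (simp add: factor_def y_carrier)

text \<open>The quotient by \<open>\<gamma>\<^sub>2\<close> is abelian and generated by involutions, so each of its elements is the product
  of a subset of the generators; multiplication by \<open>y i\<close> flips the membership of \<open>i\<close>.\<close>

lemma approximation_mod_commutators:
  assumes js: "set js = I" "distinct js" and g: "g \<in> carrier G"
  shows "\<exists>s. \<exists>z \<in> lower_central G 2. g = z \<otimes> list_prod G (map (\<lambda>i. if s i then y i else \<one>) js)"
proof -
  define N where "N = lower_central G 2"
  have N: "N \<lhd> G" unfolding N_def by (rule normal_lower_central)
  interpret f: group_hom G "G Mod N" "\<lambda>x. N #> x" by (rule hom_to_quotient(1)[OF N])
  let ?f = "\<lambda>x. N #> x" and ?H = "G Mod N"
  have comm: "a \<otimes>\<^bsub>?H\<^esub> b = b \<otimes>\<^bsub>?H\<^esub> a" if ab: "a \<in> carrier ?H" "b \<in> carrier ?H" for a b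
  proof -
    obtain a' b' where a': "a' \<in> carrier G" "a = ?f a'" and b': "b' \<in> carrier G" "b = ?f b'"
      using ab unfolding carrier_FactGroup by blast
    have "commutator G a' b' \<in> N"
      using commutator_lower_central[of a' 0 b'] a' b' by (simp add: N_def numeral_2_eq_2)
    then have "?f (commutator G a' b') = \<one>\<^bsub>?H\<^esub>"
      using hom_to_quotient(3)[OF N] a' b' commutator_closed by blast
    then show ?thesis
      using a' b' ab by (intro f.H.commutator_eq_one_imp_commute) (simp_all only: f.hom_commutator)
  qed
  let ?p = "\<lambda>s. list_prod ?H (map (\<lambda>i. if s i then ?f (y i) else \<one>\<^bsub>?H\<^esub>) js)"
  have fy: "?f (y i) \<in> carrier ?H" "?f (y i) \<otimes>\<^bsub>?H\<^esub> ?f (y i) = \<one>\<^bsub>?H\<^esub>" if "i \<in> I" for i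
  proof -
    show "?f (y i) \<in> carrier ?H" using that y_carrier f.hom_closed by blast
    have "?f (y i) \<otimes>\<^bsub>?H\<^esub> ?f (y i) = ?f (y i \<otimes> y i)"
      using that y_carrier by (simp only: f.hom_mult)
    then show "?f (y i) \<otimes>\<^bsub>?H\<^esub> ?f (y i) = \<one>\<^bsub>?H\<^esub>"
      using y_square[OF that] f.hom_one by simp
  qed
  have word: "\<exists>s. ?f (list_prod G ws) = ?p s" if "set ws \<subseteq> y ` I" for ws
    using that
  proof (induction ws)
    case Nil
    have "?p (\<lambda>_. False) = \<one>\<^bsub>?H\<^esub>" by (induction js) (simp_all del: one_FactGroup mult_FactGroup)
    then show ?case using f.hom_one by (intro exI[of _ "\<lambda>_. False"]) simp
  next
    case (Cons w ws)
    then obtain s i where s: "?f (list_prod G ws) = ?p s" and i: "i \<in> I" "w = y i" by auto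
    let ?d = "\<lambda>j. if j = i then ?f (y i) else \<one>\<^bsub>?H\<^esub>"
    let ?u = "\<lambda>s j. if s j then ?f (y j) else \<one>\<^bsub>?H\<^esub>"
    have "set ws \<subseteq> carrier G" using Cons.prems y_carrier by auto
    then have "?f (list_prod G (w # ws)) = ?f (y i) \<otimes>\<^bsub>?H\<^esub> ?p s"
      using i y_carrier s by (simp add: list_prod_closed del: mult_FactGroup)
    also have "?f (y i) = list_prod ?H (map ?d js)"
      using f.H.list_prod_single[OF js(2), of "?f (y i)" i] fy(1)[OF i(1)] i js by simp
    also have "\<dots> \<otimes>\<^bsub>?H\<^esub> ?p s = list_prod ?H (map (\<lambda>j. ?d j \<otimes>\<^bsub>?H\<^esub> ?u s j) js)"
      using fy i js by (intro f.H.list_prod_mult_central[symmetric] comm)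
        (auto simp del: one_FactGroup mult_FactGroup)
    also have "map (\<lambda>j. ?d j \<otimes>\<^bsub>?H\<^esub> ?u s j) js = map (?u (s(i := \<not> s i))) js"
      using fy i js by (intro map_cong refl) (auto simp del: one_FactGroup mult_FactGroup)
    finally show ?case by blast
  qed
  obtain ws where ws: "set ws \<subseteq> y ` I" "g = list_prod G ws"
    using g by (rule y_generate_involution)
  then obtain s where s: "?f g = ?p s" using word by blast
  let ?q = "list_prod G (map (\<lambda>i. if s i then y i else \<one>) js)"
  have q: "?q \<in> carrier G"
    using js y_carrier by (intro list_prod_closed) auto
  have "?f ?q = list_prod ?H (map ?f (map (\<lambda>i. if s i then y i else \<one>) js))"
    using js y_carrier by (intro f.hom_list_prod) auto
  also have "map ?f (map (\<lambda>i. if s i then y i else \<one>) js) = map (\<lambda>i. if s i then ?f (y i) else \<one>\<^bsub>?H\<^esub>) js"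
    using f.hom_one by simp
  finally have fq: "?f ?q = ?f g" using s by (simp only:)
  have "?f (g \<otimes> inv ?q) = ?f g \<otimes>\<^bsub>?H\<^esub> inv\<^bsub>?H\<^esub> ?f ?q"
    using g q by (simp only: f.hom_mult f.hom_inv inv_closed)
  also have "\<dots> = \<one>\<^bsub>?H\<^esub>"
    unfolding fq using g by (intro f.H.r_inv f.hom_closed)
  finally have "?f (g \<otimes> inv ?q) = \<one>\<^bsub>?H\<^esub>" .
  then have "g \<otimes> inv ?q \<in> N"
    using hom_to_quotient(3)[OF N] g q by blast
  moreover have "g = g \<otimes> inv ?q \<otimes> ?q"
    using g q by (simp add: m_assoc)
  ultimately show ?thesis
    unfolding N_def by (intro exI[of _ s] bexI[of _ "g \<otimes> inv ?q"])
qed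

text \<open>One step along the lower central series: an error \<open>z \<in> \<gamma>\<^sub>m\<^sub>+\<^sub>2\<close> is absorbed into the conjugators
  up to a new error in \<open>\<gamma>\<^sub>m\<^sub>+\<^sub>3\<close>.  Modulo \<open>\<gamma>\<^sub>m\<^sub>+\<^sub>3\<close> the old error is a product of central
  commutators \<open>[h\<^sub>i, y\<^sub>i]\<close> with \<open>h\<^sub>i \<in> \<gamma>\<^sub>m\<^sub>+\<^sub>1\<close>, and replacing \<open>a\<^sub>i\<close> by \<open>a\<^sub>i h\<^sub>i\<close> multiplies
  the \<open>i\<close>-th factor by exactly this commutator.  For \<open>m = 0\<close> the elements \<open>h\<^sub>i\<close> range over the whole
  group, which is what allows the index \<open>k\<close> to be absent from the list.\<close>

lemma refine_approximation:
  assumes xs: "insert k (set xs) = I" "distinct xs" "k \<in> set xs \<or> m = 0"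
    and z: "z \<in> lower_central G (Suc (Suc m))" and a: "\<forall>i. a i \<in> carrier G"
  shows "\<exists>z' \<in> lower_central G (Suc (Suc (Suc m))). \<exists>a'. (\<forall>i. a' i \<in> carrier G) \<and>
    z \<otimes> list_prod G (map (factor s a) xs) = z' \<otimes> list_prod G (map (factor s a') xs)"
proof -
  define N where "N = lower_central G (Suc (Suc (Suc m)))"
  define L where "L = lower_central G (Suc m)"
  have N: "N \<lhd> G" unfolding N_def by (rule normal_lower_central)
  interpret f: group_hom G "G Mod N" "\<lambda>x. N #> x" by (rule hom_to_quotient(1)[OF N])
  let ?f = "\<lambda>x. N #> x" and ?H = "G Mod N"
  note [simp del] = one_FactGroup mult_FactGroup
  have surj: "?f ` carrier G = carrier ?H" by (rule hom_to_quotient(2)[OF N])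
  have I: "i \<in> I" if "i \<in> set xs" for i using that xs by auto
  interpret C: central_commutators ?H "?f ` L" "\<lambda>i. ?f (y i)" xs
  proof (intro central_commutators.intro central_commutators_axioms.intro)
    show "group ?H" by (rule f.H.group_axioms)
    show "subgroup (?f ` L) ?H"
      unfolding L_def using normal_imp_subgroup[OF normal_lower_central]
      by (rule f.subgroup_img_is_subgroup)
    fix h g x assume "h \<in> ?f ` L" "g \<in> carrier ?H" "x \<in> carrier ?H"
    then obtain h' g' x' where h': "h' \<in> L" "h = ?f h'" and g': "g' \<in> carrier G" "g = ?f g'"
      and x': "x' \<in> carrier G" "x = ?f x'"
      unfolding carrier_FactGroup by blast
    have h'G: "h' \<in> carrier G" using h' lower_central_carrier unfolding L_def by blast
    let ?c = "commutator G h' g'"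
    have c: "?c \<in> carrier G" using h'G g' commutator_closed by blast
    have "commutator G ?c x' \<in> N"
      unfolding N_def using h' g' x' by (intro commutator_lower_central) (simp_all add: L_def)
    then have "commutator ?H (?f ?c) (?f x') = \<one>\<^bsub>?H\<^esub>"
      using hom_to_quotient(3)[OF N] c x' commutator_closed f.hom_commutator by metis
    moreover have "?f ?c = commutator ?H h g"
      unfolding h'(2) g'(2) using h'G g'(1) by (rule f.hom_commutator)
    ultimately show "commutator ?H h g \<otimes>\<^bsub>?H\<^esub> x = x \<otimes>\<^bsub>?H\<^esub> commutator ?H h g"
      using f.H.commutator_eq_one_imp_commute f.hom_closed c x' by metis
  next
    fix i assume "i \<in> set xs"
    then show "?f (y i) \<in> carrier ?H" using I y_carrier f.hom_closed by blast
  qed (use xs in simp)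
  have zG: "z \<in> carrier G" using z lower_central_carrier by blast
  have "?f z \<in> lower_central ?H (Suc (Suc m))"
    using z f.lower_central_image[OF surj] by blast
  then have "?f z \<in> generate ?H {commutator ?H h g | h g. h \<in> ?f ` L \<and> g \<in> carrier ?H}"
    unfolding lower_central_Suc_Suc f.lower_central_image[OF surj] L_def .
  also have "\<dots> \<subseteq> C.products"
  proof (rule C.generate_commutators_subset[OF xs(1)])
    have "generate ?H (?f ` y ` I) = ?f ` generate G (y ` I)"
      using y_carrier by (intro f.generate_img) auto
    then show "generate ?H ((\<lambda>i. ?f (y i)) ` I) = carrier ?H"
      using generate_y surj by (simp add: image_image)
    show "?f (y k) \<in> carrier ?H" using xs y_carrier f.hom_closed by blast
    show "k \<in> set xs \<or> ?f ` L = carrier ?H"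
      using xs(3) surj by (auto simp: L_def)
  qed
  finally obtain h where h: "\<forall>i. h i \<in> ?f ` L"
    "?f z = list_prod ?H (map (\<lambda>i. commutator ?H (h i) (?f (y i))) xs)"
    unfolding C.products_def by blast
  have "\<forall>i. \<exists>x. x \<in> L \<and> h i = ?f x" using h(1) by blast
  then obtain h' where h': "\<And>i. h' i \<in> L" "\<And>i. h i = ?f (h' i)" by metis
  have h'G: "h' i \<in> carrier G" for i using h' lower_central_carrier unfolding L_def by blast
  define a' where "a' i = a i \<otimes> h' i" for i
  have a': "\<forall>i. a' i \<in> carrier G" using a h'G by (simp add: a'_def)
  have step: "?f (factor s a' i) = commutator ?H (h i) (?f (y i)) \<otimes>\<^bsub>?H\<^esub> ?f (factor s a i)"
    if i: "i \<in> set xs" for i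
  proof -
    have yi: "y i \<in> carrier G" using i I y_carrier by blast
    let ?c = "commutator G (h' i) (y i)" and ?e = "if s i then \<one> else y i"
    have c: "?c \<in> carrier G" and e: "?e \<in> carrier G" and ai: "a i \<in> carrier G"
      using h'G yi a commutator_closed by auto
    have fc: "?f ?c = commutator ?H (h i) (?f (y i))"
      using h'G yi h' by (simp only: f.hom_commutator)
    have central: "?f ?c \<otimes>\<^bsub>?H\<^esub> x = x \<otimes>\<^bsub>?H\<^esub> ?f ?c" if "x \<in> carrier ?H" for x
      unfolding fc using that h(1) i C.y by (intro C.central) auto
    have "factor s a' i = ?e \<otimes> a i \<otimes> ?c \<otimes> (y i \<otimes> inv (a i))"
      using h'G[of i] yi ai e
      by (simp add: factor_def a'_def commutator_def m_assoc inv_mult_group inv_cancel_left)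
    then have "?f (factor s a' i) = ?f (?e \<otimes> a i) \<otimes>\<^bsub>?H\<^esub> ?f ?c \<otimes>\<^bsub>?H\<^esub> ?f (y i \<otimes> inv (a i))"
      using c e ai yi by (simp only: f.hom_mult m_closed inv_closed)
    also have "\<dots> = ?f ?c \<otimes>\<^bsub>?H\<^esub> ?f (?e \<otimes> a i) \<otimes>\<^bsub>?H\<^esub> ?f (y i \<otimes> inv (a i))"
      using c e ai yi by (simp only: central f.hom_closed m_closed)
    also have "\<dots> = ?f (?c \<otimes> (?e \<otimes> a i) \<otimes> (y i \<otimes> inv (a i)))"
      using c e ai yi by (simp only: f.hom_mult m_closed inv_closed)
    also have "?c \<otimes> (?e \<otimes> a i) \<otimes> (y i \<otimes> inv (a i)) = ?c \<otimes> factor s a i"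
      using c e ai yi by (simp add: factor_def m_assoc)
    also have "?f (?c \<otimes> factor s a i) = ?f ?c \<otimes>\<^bsub>?H\<^esub> ?f (factor s a i)"
      using c i I ai by (intro f.hom_mult factor_closed) auto
    finally show ?thesis unfolding fc .
  qed
  let ?p = "list_prod G (map (factor s a) xs)" and ?p' = "list_prod G (map (factor s a') xs)"
  have sub: "set (map (factor s a) xs) \<subseteq> carrier G" "set (map (factor s a') xs) \<subseteq> carrier G"
    using I a a' factor_closed by auto
  have pG: "?p \<in> carrier G" "?p' \<in> carrier G"
    by (rule list_prod_closed[OF sub(1)], rule list_prod_closed[OF sub(2)])
  have "?f ?p' = list_prod ?H (map (\<lambda>i. ?f (factor s a' i)) xs)"
    using f.hom_list_prod[OF sub(2)] by (simp only: map_map comp_def)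
  also have "map (\<lambda>i. ?f (factor s a' i)) xs =
      map (\<lambda>i. commutator ?H (h i) (?f (y i)) \<otimes>\<^bsub>?H\<^esub> ?f (factor s a i)) xs"
    using step by (intro map_cong refl)
  also have "list_prod ?H \<dots> = ?f z \<otimes>\<^bsub>?H\<^esub> list_prod ?H (map (\<lambda>i. ?f (factor s a i)) xs)"
    unfolding h(2)
  proof (rule f.H.list_prod_mult_central)
    fix i assume i: "i \<in> set xs"
    show "commutator ?H (h i) (?f (y i)) \<in> carrier ?H"
      using h(1) C.L_carrier C.y[OF i] by (intro f.H.commutator_closed) auto
    show "?f (factor s a i) \<in> carrier ?H"
      using i I a factor_closed f.hom_closed by blast
    fix x assume "x \<in> carrier ?H"
    then show "commutator ?H (h i) (?f (y i)) \<otimes>\<^bsub>?H\<^esub> x = x \<otimes>\<^bsub>?H\<^esub> commutator ?H (h i) (?f (y i))"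
      using h(1) C.y[OF i] by (intro C.central) auto
  qed
  also have "list_prod ?H (map (\<lambda>i. ?f (factor s a i)) xs) = ?f ?p"
    using f.hom_list_prod[OF sub(1)] by (simp only: map_map comp_def)
  also have "?f z \<otimes>\<^bsub>?H\<^esub> ?f ?p = ?f (z \<otimes> ?p)"
    using zG pG by (simp only: f.hom_mult)
  finally have eq: "?f ?p' = ?f (z \<otimes> ?p)" .
  have "?f (z \<otimes> ?p \<otimes> inv ?p') = ?f (z \<otimes> ?p) \<otimes>\<^bsub>?H\<^esub> inv\<^bsub>?H\<^esub> ?f ?p'"
    using zG pG by (simp only: f.hom_mult f.hom_inv m_closed inv_closed)
  also have "\<dots> = \<one>\<^bsub>?H\<^esub>"
    unfolding eq using zG pG by (intro f.H.r_inv f.hom_closed m_closed)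
  finally have "z \<otimes> ?p \<otimes> inv ?p' \<in> N"
    using zG pG by (subst (asm) hom_to_quotient(3)[OF N]) (intro m_closed inv_closed)
  moreover have "z \<otimes> ?p = (z \<otimes> ?p \<otimes> inv ?p') \<otimes> ?p'"
    using zG pG by (simp add: m_assoc)
  ultimately show ?thesis
    using a' unfolding N_def
    by (intro bexI[of _ "z \<otimes> ?p \<otimes> inv ?p'"] exI[of _ a'] conjI)
qed

lemma iterate_refinement:
  assumes xs: "insert k (set xs) = I" "distinct xs"
    and z: "z \<in> lower_central G 2" and a: "\<forall>i. a i \<in> carrier G"
    and k: "k \<in> set xs \<or> m \<le> 1"
  shows "\<exists>z' \<in> lower_central G (Suc (Suc m)). \<exists>a'. (\<forall>i. a' i \<in> carrier G) \<and>
    z \<otimes> list_prod G (map (factor s a) xs) = z' \<otimes> list_prod G (map (factor s a') xs)"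
  using k
proof (induction m)
  case 0
  show ?case
    using z a by (intro bexI[of _ z] exI[of _ a]) (simp_all add: numeral_2_eq_2)
next
  case (Suc m)
  then have m: "k \<in> set xs \<or> m \<le> 1" "k \<in> set xs \<or> m = 0" by auto
  obtain z' a' where z': "z' \<in> lower_central G (Suc (Suc m))" "\<forall>i. a' i \<in> carrier G"
    and eq: "z \<otimes> list_prod G (map (factor s a) xs) = z' \<otimes> list_prod G (map (factor s a') xs)"
    using Suc.IH[OF m(1)] by blast
  show ?case
    unfolding eq by (rule refine_approximation[OF xs m(2) z'])
qed

text \<open>In a group of class \<open>r\<close> the error disappears after \<open>r - 1\<close> refinements, started from trivial
  conjugators.  An absent index \<open>k\<close> is possible only if a single refinement suffices.\<close>

lemma exact_factorisation:
  assumes xs: "insert k (set xs) = I" "distinct xs"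
    and nilpotent: "lower_central G (Suc r) = {\<one>}" "r \<ge> 1"
    and g: "z \<in> lower_central G 2" "g = z \<otimes> list_prod G (map (\<lambda>i. if s i then y i else \<one>) xs)"
    and k: "k \<in> set xs \<or> r \<le> 2"
  obtains a where "\<forall>i. a i \<in> carrier G" "g = list_prod G (map (factor s a) xs)"
proof -
  have "map (\<lambda>i. if s i then y i else \<one>) xs = map (factor s (\<lambda>_. \<one>)) xs"
    using xs y_carrier y_square by (intro map_cong) (auto simp: factor_def)
  then have g': "g = z \<otimes> list_prod G (map (factor s (\<lambda>_. \<one>)) xs)"
    using g(2) by (simp only:)
  obtain m where m: "r = Suc m" using nilpotent(2) by (cases r) auto
  have "k \<in> set xs \<or> m \<le> 1" using k m by auto
  with iterate_refinement[OF xs g(1), of "\<lambda>_. \<one>" m s]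
  obtain z' a' where a': "z' \<in> lower_central G (Suc (Suc m))" "\<forall>i. a' i \<in> carrier G"
    and eq: "g = z' \<otimes> list_prod G (map (factor s a') xs)"
    unfolding g' by blast
  have "set (map (factor s a') xs) \<subseteq> carrier G"
    using a'(2) xs factor_closed by auto
  moreover have "z' = \<one>"
    using a'(1) nilpotent(1) m by simp
  ultimately have "g = list_prod G (map (factor s a') xs)"
    unfolding eq by (simp add: list_prod_closed del: foldr_map)
  then show thesis using that a'(2) by blast
qed

end

lemma palindromic_length_le:
  assumes "set ps \<subseteq> palindromes G S" "length ps \<le> n"
  shows "palindromic_length G S (list_prod G ps) \<le> enat n"
proof -
  have "palindromic_length G S (list_prod G ps) \<le> enat (length ps)"
    unfolding palindromic_length_def using assms(1) by (intro Inf_lower) blast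
  also have "\<dots> \<le> enat n" using assms(2) by simp
  finally show ?thesis .
qed

lemma palindromic_length_ge:
  assumes "\<And>ps. set ps \<subseteq> palindromes G S \<Longrightarrow> list_prod G ps = g \<Longrightarrow> n \<le> length ps"
  shows "enat n \<le> palindromic_length G S g"
  unfolding palindromic_length_def using assms by (intro Inf_greatest) auto

context involution_generated
begin

lemma palindromes_eq_conjugates:
  "palindromes G (y ` I) = insert \<one> {g \<otimes> y i \<otimes> inv g | g i. g \<in> carrier G \<and> i \<in> I}"
proof -
  have "palindromes G (y ` I) = insert \<one> {g \<otimes> s \<otimes> inv g | g s. g \<in> generate G (y ` I) \<and> s \<in> y ` I}"
    using y_carrier y_square by (intro palindromes_involutions) auto
  then show ?thesis unfolding generate_y by blast
qed

lemma palindromic_length_factors: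
  assumes xs: "set xs \<subseteq> I" and a: "\<forall>i. a i \<in> carrier G"
    and n: "length xs + length (filter (\<lambda>i. \<not> s i) xs) \<le> n"
  shows "palindromic_length G (y ` I) (list_prod G (map (factor s a) xs)) \<le> enat n"
proof -
  let ?c = "\<lambda>i. a i \<otimes> y i \<otimes> inv (a i)"
  let ?l = "\<lambda>i. if s i then [?c i] else [y i, ?c i]"
  have yc: "y i \<in> carrier G" "?c i \<in> carrier G" if "i \<in> I" for i
    using that a y_carrier by auto
  have "map (list_prod G) (map ?l xs) = map (factor s a) xs"
    using xs yc by (auto simp: factor_def)
  moreover have "list_prod G (concat (map ?l xs)) = list_prod G (map (list_prod G) (map ?l xs))"
    using xs yc by (intro list_prod_concat) (fastforce split: if_splits)
  ultimately have prod: "list_prod G (concat (map ?l xs)) = list_prod G (map (factor s a) xs)"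
    by (simp only:)
  have len: "length (concat (map ?l xs)) = length xs + length (filter (\<lambda>i. \<not> s i) xs)"
    by (induction xs) auto
  have "?c i \<in> palindromes G (y ` I)" if "i \<in> I" for i
    unfolding palindromes_eq_conjugates using that a by blast
  moreover have "y i \<in> palindromes G (y ` I)" if "i \<in> I" for i
  proof -
    have "y i = \<one> \<otimes> y i \<otimes> inv \<one>" using yc that by simp
    then show ?thesis
      unfolding palindromes_eq_conjugates using that
      by (intro insertI2 CollectI exI[of _ \<one>] exI[of _ i]) simp
  qed
  ultimately have "set (concat (map ?l xs)) \<subseteq> palindromes G (y ` I)"
    using xs by (auto split: if_splits)
  then show ?thesis
    unfolding prod[symmetric] using n len by (intro palindromic_length_le) simp_all
qed

theorem palindromic_width_le_twice_rank:
  assumes "finite I" "I \<noteq> {}" "lower_central G (Suc r) = {\<one>}" "r \<ge> 1"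
  shows "palindromic_width G (y ` I) \<le> enat (2 * card I)"
  unfolding palindromic_width_def
proof (rule SUP_least)
  fix g assume g: "g \<in> carrier G"
  obtain js where js: "set js = I" "distinct js"
    using assms(1) finite_distinct_list by blast
  obtain k where k: "k \<in> set js" using assms(2) js by blast
  then have ins: "insert k (set js) = I" using js by auto
  obtain s z where z: "z \<in> lower_central G 2"
    "g = z \<otimes> list_prod G (map (\<lambda>i. if s i then y i else \<one>) js)"
    using approximation_mod_commutators[OF js g] by blast
  obtain a where a: "\<forall>i. a i \<in> carrier G" and ga: "g = list_prod G (map (factor s a) js)"
    using exact_factorisation[OF ins js(2) assms(3,4) z] k by blast
  have "length js = card I" using js distinct_card by metis
  moreover have "length (filter (\<lambda>i. \<not> s i) js) \<le> length js" by simp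
  ultimately show "palindromic_length G (y ` I) g \<le> enat (2 * card I)"
    unfolding ga using js a by (intro palindromic_length_factors) auto
qed

text \<open>The index left out is one whose generator does not occur modulo the commutator subgroup; its factor
  would have been trivial in the initial approximation.\<close>

theorem palindromic_width_le_class_two:
  assumes "finite I" "card I \<ge> 2" "lower_central G 3 = {\<one>}"
  shows "palindromic_width G (y ` I) \<le> enat (2 * (card I - 1))"
  unfolding palindromic_width_def
proof (rule SUP_least)
  fix g assume g: "g \<in> carrier G"
  have class_two: "lower_central G (Suc 2) = {\<one>}" "(2::nat) \<ge> 1"
    using assms(3) by (simp_all add: numeral_3_eq_3 numeral_2_eq_2)
  obtain js where js: "set js = I" "distinct js"
    using assms(1) finite_distinct_list by blast
  have len: "length js = card I" using js distinct_card by metis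
  obtain s z where z: "z \<in> lower_central G 2"
    "g = z \<otimes> list_prod G (map (\<lambda>i. if s i then y i else \<one>) js)"
    using approximation_mod_commutators[OF js g] by blast
  show "palindromic_length G (y ` I) g \<le> enat (2 * (card I - 1))"
  proof (cases "\<forall>i\<in>I. s i")
    case True
    obtain k where k: "k \<in> set js" using assms(2) js len by (cases js) auto
    then have ins: "insert k (set js) = I" using js by auto
    obtain a where a: "\<forall>i. a i \<in> carrier G" and ga: "g = list_prod G (map (factor s a) js)"
      using exact_factorisation[OF ins js(2) class_two z] k by blast
    have "filter (\<lambda>i. \<not> s i) js = []" using True js by (simp add: filter_empty_conv)
    then show ?thesis
      unfolding ga using js a len assms(2) by (intro palindromic_length_factors) auto
  next
    case False
    then obtain k where k: "k \<in> I" "\<not> s k" by blast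
    let ?xs = "filter (\<lambda>i. i \<noteq> k) js"
    have ins: "insert k (set ?xs) = I" and dist: "distinct ?xs" using js k by auto
    have eq: "list_prod G (map (\<lambda>i. if s i then y i else \<one>) ?xs) =
        list_prod G (map (\<lambda>i. if s i then y i else \<one>) js)"
      using js k y_carrier by (intro list_prod_filter) auto
    obtain a where a: "\<forall>i. a i \<in> carrier G" and ga: "g = list_prod G (map (factor s a) ?xs)"
      using exact_factorisation[OF ins dist class_two z(1), of g s] z(2) unfolding eq by blast
    have "set ?xs = I - {k}" using js by auto
    then have "card (set ?xs) = card I - 1"
      using k(1) assms(1) by (simp add: card_Diff_singleton)
    then have "length ?xs = card I - 1"
      using dist distinct_card by metis
    moreover have "length (filter (\<lambda>i. \<not> s i) ?xs) \<le> length ?xs" by (rule length_filter_le)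
    ultimately show ?thesis
      unfolding ga using js a by (intro palindromic_length_factors) auto
  qed
qed

end


section \<open>Lower bounds from the unitriangular group of order eight\<close>

text \<open>The upper unitriangular \<open>3 \<times> 3\<close> matrices over the field with two elements (the dihedral group of
  order eight): \<open>(a, b, c)\<close> lists the entries at positions \<open>(1,2)\<close>, \<open>(2,3)\<close> and \<open>(1,3)\<close>.\<close>

definition unitriangular :: "(bool \<times> bool \<times> bool) monoid" where
  "unitriangular = \<lparr>carrier = UNIV,
     mult = (\<lambda>(a, b, c) (a', b', c'). (a \<noteq> a', b \<noteq> b', (c \<noteq> c') \<noteq> (a \<and> b'))),
     one = (False, False, False)\<rparr>"

lemma unitriangular_simps [simp]:
  "carrier unitriangular = UNIV"
  "(a, b, c) \<otimes>\<^bsub>unitriangular\<^esub> (a', b', c') = (a \<noteq> a', b \<noteq> b', (c \<noteq> c') \<noteq> (a \<and> b'))"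
  "\<one>\<^bsub>unitriangular\<^esub> = (False, False, False)"
  by (simp_all add: unitriangular_def)

interpretation U: group unitriangular
proof (rule groupI)
  fix x :: "bool \<times> bool \<times> bool"
  obtain a b c where "x = (a, b, c)" by (cases x)
  then show "\<exists>z\<in>carrier unitriangular. z \<otimes>\<^bsub>unitriangular\<^esub> x = \<one>\<^bsub>unitriangular\<^esub>"
    by (intro bexI[of _ "(a, b, c \<noteq> (a \<and> b))"]) auto
qed (auto simp: split_paired_all)

lemma inv_unitriangular: "inv\<^bsub>unitriangular\<^esub> (a, b, c) = (a, b, c \<noteq> (a \<and> b))"
  by (rule U.inv_equality) auto

lemma lower_central_unitriangular:
  assumes "k \<ge> 3"
  shows "lower_central unitriangular k = {\<one>\<^bsub>unitriangular\<^esub>}"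
proof -
  let ?Z = "{x :: bool \<times> bool \<times> bool. \<not> fst x \<and> \<not> fst (snd x)}"
  have Z: "subgroup ?Z unitriangular"
    by (rule U.subgroupI) (auto simp: inv_unitriangular)
  have "lower_central unitriangular (Suc (Suc 0)) \<subseteq> ?Z"
    unfolding lower_central_Suc_Suc
    by (rule U.generate_subgroup_incl[OF _ Z]) (auto simp: commutator_def inv_unitriangular)
  then have "{commutator unitriangular h g | h g.
      h \<in> lower_central unitriangular (Suc (Suc 0)) \<and> g \<in> carrier unitriangular} \<subseteq> {\<one>\<^bsub>unitriangular\<^esub>}"
    by (fastforce simp: commutator_def inv_unitriangular)
  then have three: "lower_central unitriangular (Suc (Suc (Suc 0))) \<subseteq> {\<one>\<^bsub>unitriangular\<^esub>}"
    by (subst lower_central_Suc_Suc) (rule U.generate_subgroup_incl[OF _ U.triv_subgroup])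
  have "lower_central unitriangular (Suc (Suc (Suc m))) \<subseteq> {\<one>\<^bsub>unitriangular\<^esub>}" for m
  proof (induction m)
    case (Suc m)
    then have "{commutator unitriangular h g | h g. h \<in> lower_central unitriangular (Suc (Suc (Suc m)))
        \<and> g \<in> carrier unitriangular} \<subseteq> {\<one>\<^bsub>unitriangular\<^esub>}"
      by (fastforce simp: commutator_def inv_unitriangular)
    then show ?case
      by (subst lower_central_Suc_Suc) (rule U.generate_subgroup_incl[OF _ U.triv_subgroup])
  qed (rule three)
  moreover have "k = Suc (Suc (Suc (k - 3)))" using assms by simp
  ultimately have "lower_central unitriangular k \<subseteq> {\<one>\<^bsub>unitriangular\<^esub>}" by metis
  moreover have "\<one>\<^bsub>unitriangular\<^esub> \<in> lower_central unitriangular k"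
    using normal_imp_subgroup[OF U.normal_lower_central] by (rule subgroup.one_closed)
  ultimately show ?thesis by blast
qed

lemma fst_unitriangular_mult: "fst (x \<otimes>\<^bsub>unitriangular\<^esub> x') = (fst x \<noteq> fst x')"
  by (cases x; cases x') simp

lemma fst_snd_unitriangular_mult:
  "fst (snd (x \<otimes>\<^bsub>unitriangular\<^esub> x')) = (fst (snd x) \<noteq> fst (snd x'))"
  by (cases x; cases x') simp

lemma fst_unitriangular_conjugate:
  "fst (g \<otimes>\<^bsub>unitriangular\<^esub> x \<otimes>\<^bsub>unitriangular\<^esub> inv\<^bsub>unitriangular\<^esub> g) = fst x"
  by (cases g; cases x) (auto simp: inv_unitriangular)

lemma unitriangular_conjugate_one:
  "g \<otimes>\<^bsub>unitriangular\<^esub> (False, False, False) \<otimes>\<^bsub>unitriangular\<^esub> inv\<^bsub>unitriangular\<^esub> g =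
    (False, False, False)"
  by (cases g) (auto simp: inv_unitriangular)

lemma unitriangular_square:
  "fst x \<Longrightarrow> fst (snd x) \<Longrightarrow> x \<otimes>\<^bsub>unitriangular\<^esub> x = (False, False, True)"
  by (cases x) simp

text \<open>The hypothesis provides a map to the unitriangular group for each pair of indices.  The first
  coordinate of such a map counts the conjugates of \<open>y i\<close> modulo two, which settles parity; a factorisation
  that avoids both \<open>i\<close> and \<open>j\<close> would have trivial image, while the square of the product of all
  generators does not.\<close>

theorem (in involution_generated) palindromic_width_ge:
  assumes I: "finite I" "card I \<ge> 2"
    and reps: "\<And>i j. i \<in> I \<Longrightarrow> j \<in> I \<Longrightarrow> i \<noteq> j \<Longrightarrow>
      \<exists>\<psi> \<in> hom G unitriangular. \<forall>m\<in>I. \<psi> (y m) = (m = i, m = j, False)"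
  shows "enat (2 * (card I - 1)) \<le> palindromic_width G (y ` I)"
proof -
  obtain js where js: "set js = I" "distinct js"
    using I(1) finite_distinct_list by blast
  define p where "p = list_prod G (map y js)"
  have yjs: "set (map y js) \<subseteq> carrier G" using js y_carrier by auto
  have p: "p \<in> carrier G" unfolding p_def using yjs by (rule list_prod_closed)
  have "2 * (card I - 1) \<le> length ps"
    if ps: "set ps \<subseteq> palindromes G (y ` I)" "list_prod G ps = p \<otimes> p" for ps
  proof -
    have "\<forall>x\<in>set ps. \<exists>t. case t of None \<Rightarrow> x = \<one>
        | Some i \<Rightarrow> i \<in> I \<and> (\<exists>g\<in>carrier G. x = g \<otimes> y i \<otimes> inv g)" (is "\<forall>x\<in>_. \<exists>t. ?Q x t")
    proof
      fix x assume "x \<in> set ps"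
      then have "x \<in> insert \<one> {g \<otimes> y i \<otimes> inv g | g i. g \<in> carrier G \<and> i \<in> I}"
        using ps(1) unfolding palindromes_eq_conjugates by blast
      then consider "x = \<one>" | g i where "g \<in> carrier G" "i \<in> I" "x = g \<otimes> y i \<otimes> inv g"
        by blast
      then show "\<exists>t. ?Q x t"
      proof cases
        case 1
        then show ?thesis by (intro exI[of _ None]) simp
      next
        case 2
        then show ?thesis by (intro exI[of _ "Some i"]) auto
      qed
    qed
    \<comment> \<open>\<open>\<kappa>\<close> picks for each palindrome a generator of which it is a conjugate, \<open>None\<close> for the identity.\<close>
    from bchoice[OF this] obtain \<kappa> where \<kappa>: "\<forall>x\<in>set ps. ?Q x (\<kappa> x)" ..
    have \<kappa>_None: "x = \<one>" if "x \<in> set ps" "\<kappa> x = None" for x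
      using bspec[OF \<kappa> that(1)] that(2) by simp
    have \<kappa>_Some: "i \<in> I" "\<exists>g\<in>carrier G. x = g \<otimes> y i \<otimes> inv g"
      if "x \<in> set ps" "\<kappa> x = Some i" for x i
      using bspec[OF \<kappa> that(1)] that(2) by simp_all
    define occ where "occ i = length (filter (\<lambda>x. \<kappa> x = Some i) ps)" for i
    have psG: "set ps \<subseteq> carrier G"
    proof
      fix x assume x: "x \<in> set ps"
      show "x \<in> carrier G"
        using \<kappa>_None[OF x] \<kappa>_Some[OF x] y_carrier by (cases "\<kappa> x") force+
    qed
    have pair: "even (occ i) \<and> (occ i = 0 \<longrightarrow> occ j \<noteq> 0)" if ij: "i \<in> I" "j \<in> I" "i \<noteq> j" for i j
    proof -
      obtain \<psi> where \<psi>: "\<psi> \<in> hom G unitriangular" "\<And>m. m \<in> I \<Longrightarrow> \<psi> (y m) = (m = i, m = j, False)"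
        using reps[OF ij] by blast
      interpret \<psi>: group_hom G unitriangular \<psi>
        using \<psi>(1) by unfold_locales
      have "fst (list_prod unitriangular (map \<psi> (map y zs))) = (i \<in> set zs) \<and>
          fst (snd (list_prod unitriangular (map \<psi> (map y zs)))) = (j \<in> set zs)"
        if "set zs \<subseteq> I" "distinct zs" for zs
        using that
        by (induction zs) (auto simp: fst_unitriangular_mult fst_snd_unitriangular_mult \<psi>(2))
      then have "fst (\<psi> p)" "fst (snd (\<psi> p))"
        unfolding p_def \<psi>.hom_list_prod[OF yjs] using js ij by auto
      then have \<psi>pp: "\<psi> (p \<otimes> p) = (False, False, True)"
        using p by (simp add: unitriangular_square)
      have psi_values: "fst (\<psi> x) = (\<kappa> x = Some i)"
        "\<kappa> x \<noteq> Some i \<Longrightarrow> \<kappa> x \<noteq> Some j \<Longrightarrow> \<psi> x = \<one>\<^bsub>unitriangular\<^esub>"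
        if x: "x \<in> set ps" for x
      proof (atomize (full), cases "\<kappa> x")
        case None
        then show "(fst (\<psi> x) = (\<kappa> x = Some i)) \<and> (\<kappa> x \<noteq> Some i \<longrightarrow> \<kappa> x \<noteq> Some j \<longrightarrow> \<psi> x = \<one>\<^bsub>unitriangular\<^esub>)"
          using \<kappa>_None[OF x] \<psi>.hom_one by simp
      next
        case (Some m)
        then obtain g where g: "g \<in> carrier G" "x = g \<otimes> y m \<otimes> inv g" and m: "m \<in> I"
          using \<kappa>_Some[OF x] by blast
        have "\<psi> x = \<psi> g \<otimes>\<^bsub>unitriangular\<^esub> \<psi> (y m) \<otimes>\<^bsub>unitriangular\<^esub> inv\<^bsub>unitriangular\<^esub> \<psi> g"
          unfolding g(2) using g(1) y_carrier[OF m] by simp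
        then show "(fst (\<psi> x) = (\<kappa> x = Some i)) \<and> (\<kappa> x \<noteq> Some i \<longrightarrow> \<kappa> x \<noteq> Some j \<longrightarrow> \<psi> x = \<one>\<^bsub>unitriangular\<^esub>)"
          using Some \<psi>(2)[OF m]
          by (simp add: fst_unitriangular_conjugate unitriangular_conjugate_one)
      qed
      have "fst (list_prod unitriangular (map \<psi> qs)) = odd (length (filter (\<lambda>x. \<kappa> x = Some i) qs))"
        if "set qs \<subseteq> set ps" for qs
        using that by (induction qs) (auto simp: fst_unitriangular_mult psi_values)
      then have "fst (\<psi> (p \<otimes> p)) = odd (occ i)"
        unfolding ps(2)[symmetric] \<psi>.hom_list_prod[OF psG] occ_def by blast
      then have even: "even (occ i)" using \<psi>pp by simp
      have False if "occ i = 0" "occ j = 0"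
      proof -
        have "\<psi> x = \<one>\<^bsub>unitriangular\<^esub>" if x: "x \<in> set ps" for x
        proof -
          have "\<kappa> x \<noteq> Some i" "\<kappa> x \<noteq> Some j"
            using x \<open>occ i = 0\<close> \<open>occ j = 0\<close> unfolding occ_def by (auto simp: filter_empty_conv)
          then show ?thesis by (rule psi_values(2)[OF x])
        qed
        then have "list_prod unitriangular (map \<psi> qs) = \<one>\<^bsub>unitriangular\<^esub>" if "set qs \<subseteq> set ps" for qs
          using that by (induction qs) auto
        then have "\<psi> (p \<otimes> p) = \<one>\<^bsub>unitriangular\<^esub>"
          unfolding ps(2)[symmetric] \<psi>.hom_list_prod[OF psG] by blast
        then show False using \<psi>pp by simp
      qed
      with even show ?thesis by blast
    qed
    define Z where "Z = {i \<in> I. occ i = 0}"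
    have "\<forall>i\<in>Z. \<forall>j\<in>Z. i = j" unfolding Z_def using pair by blast
    then have "card Z \<le> 1"
      using I(1) card_le_Suc0_iff_eq[of Z] by (simp add: Z_def)
    have two: "occ i \<ge> 2" if i: "i \<in> I - Z" for i
    proof -
      have "\<not> I \<subseteq> {i}" using I card_mono[of "{i}" I] by auto
      then obtain j where "j \<in> I" "i \<noteq> j" by blast
      then have "even (occ i)" using pair i by blast
      moreover have "occ i \<noteq> 0" using i by (auto simp: Z_def)
      ultimately show ?thesis by presburger
    qed
    have "card I - 1 \<le> card (I - Z)"
      using \<open>card Z \<le> 1\<close> I(1) by (subst card_Diff_subset) (auto simp: Z_def)
    then have "2 * (card I - 1) \<le> (\<Sum>i\<in>I - Z. 2)" by simp
    also have "\<dots> \<le> (\<Sum>i\<in>I - Z. occ i)" using two by (intro sum_mono) auto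
    also have "\<dots> \<le> (\<Sum>i\<in>I. occ i)" using I(1) by (intro sum_mono2) auto
    also have "\<dots> \<le> length ps"
      unfolding occ_def
    proof (induction ps)
      case (Cons x ps)
      have "(\<Sum>i\<in>I. length (filter (\<lambda>x. \<kappa> x = Some i) (x # ps))) =
          (\<Sum>i\<in>I. if \<kappa> x = Some i then 1 else 0) + (\<Sum>i\<in>I. length (filter (\<lambda>x. \<kappa> x = Some i) ps))"
        by (subst sum.distrib[symmetric]) (auto intro!: sum.cong)
      also have "(\<Sum>i\<in>I. if \<kappa> x = Some i then 1 else 0) \<le> (1 :: nat)"
        using I(1) by (cases "\<kappa> x") auto
      finally show ?case using Cons by simp
    qed simp
    finally show ?thesis .
  qed
  then have "enat (2 * (card I - 1)) \<le> palindromic_length G (y ` I) (p \<otimes> p)"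
    by (rule palindromic_length_ge)
  also have "\<dots> \<le> palindromic_width G (y ` I)"
    unfolding palindromic_width_def using p by (intro SUP_upper) simp
  finally show ?thesis .
qed


section \<open>The groups defined by generators and relations\<close>

definition letter_value :: "('b, 'c) monoid_scheme \<Rightarrow> ('i \<Rightarrow> 'b) \<Rightarrow> 'i letter \<Rightarrow> 'b" where
  "letter_value H v a = (if snd a then v (fst a) else inv\<^bsub>H\<^esub> v (fst a))"

text \<open>The universal property of the free group.  Evaluation of words is unchanged by the cancellations that
  reduce a product.\<close>

lemma free_group_hom:
  assumes "group H" "\<And>i. i \<in> A \<Longrightarrow> v i \<in> carrier H"
  obtains \<phi> where "\<phi> \<in> hom (free_group A) H" "\<And>i. i \<in> A \<Longrightarrow> \<phi> [(i, True)] = v i"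
proof -
  interpret H: group H by fact
  let ?v = "letter_value H v"
  let ?\<phi> = "\<lambda>w. list_prod H (map ?v w)"
  have v: "?v a \<in> carrier H" if "a \<in> A \<times> UNIV" for a
    using that assms(2) by (auto simp: letter_value_def)
  have closed: "?\<phi> w \<in> carrier H" if "set w \<subseteq> A \<times> UNIV" for w
    using that v by (intro H.list_prod_closed) auto
  have v_inv: "?v a \<otimes>\<^bsub>H\<^esub> ?v (inv_letter a) = \<one>\<^bsub>H\<^esub>" if "a \<in> A \<times> UNIV" for a
    using that assms(2) by (auto simp: letter_value_def inv_letter_def)
  have cancel: "?\<phi> (cancel_Cons a w) = ?v a \<otimes>\<^bsub>H\<^esub> ?\<phi> w"
    if "a \<in> A \<times> UNIV" "set w \<subseteq> A \<times> UNIV" for a w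
  proof (cases w)
    case (Cons b u)
    have "?v a \<otimes>\<^bsub>H\<^esub> (?v (inv_letter a) \<otimes>\<^bsub>H\<^esub> ?\<phi> u) = ?\<phi> u" if "b = inv_letter a"
    proof -
      have "?\<phi> u \<in> carrier H" "?v (inv_letter a) \<in> carrier H" "?v a \<in> carrier H"
        using closed v \<open>a \<in> A \<times> UNIV\<close> \<open>set w \<subseteq> A \<times> UNIV\<close> \<open>b = inv_letter a\<close> Cons by auto
      then show ?thesis
        using v_inv[OF \<open>a \<in> A \<times> UNIV\<close>] by (simp flip: H.m_assoc)
    qed
    then show ?thesis using Cons by auto
  qed simp
  have foldr: "?\<phi> (foldr cancel_Cons u w) = ?\<phi> u \<otimes>\<^bsub>H\<^esub> ?\<phi> w"
    if "set u \<subseteq> A \<times> UNIV" "set w \<subseteq> A \<times> UNIV" for u w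
    using that(1)
  proof (induction u)
    case Nil
    then show ?case using closed[OF that(2)] by simp
  next
    case (Cons a u)
    have "set (foldr cancel_Cons u w) \<subseteq> A \<times> UNIV"
      using set_foldr[of u w] Cons.prems that(2) by auto
    then show ?case
      using Cons cancel[of a "foldr cancel_Cons u w"] v closed[OF that(2)] closed[of u]
      by (simp add: H.m_assoc)
  qed
  have "?\<phi> \<in> hom (free_group A) H"
  proof (rule homI)
    fix x y assume xy: "x \<in> carrier (free_group A)" "y \<in> carrier (free_group A)"
    then show "?\<phi> (x \<otimes>\<^bsub>free_group A\<^esub> y) = ?\<phi> x \<otimes>\<^bsub>H\<^esub> ?\<phi> y"
      using foldr[of x y] by (simp add: free_group_def free_reduce_append)
  qed (use closed in \<open>auto simp: free_group_def\<close>)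
  moreover have "?\<phi> [(i, True)] = v i" if "i \<in> A" for i
    using assms(2)[OF that] by (simp add: letter_value_def)
  ultimately show thesis using that by blast
qed

lemma generate_free_group:
  "generate (free_group A) ((\<lambda>i. [(i, True)]) ` A) = carrier (free_group A)"
proof
  interpret F: group "free_group A" by (rule group_free_group)
  let ?S = "(\<lambda>i. [(i, True)]) ` A"
  have S: "?S \<subseteq> carrier (free_group A)"
    by (auto simp: free_group_def reduced_def)
  show "generate (free_group A) ?S \<subseteq> carrier (free_group A)"
    using S by (rule F.generate_incl)
  have letter: "[(i, e)] \<in> generate (free_group A) ?S" if "i \<in> A" for i e
  proof (cases e)
    case False
    have "inv\<^bsub>free_group A\<^esub> [(i, True)] = [(i, False)]"
      using that
      by (intro F.inv_equality) (auto simp: free_group_def free_reduce_def reduced_def inv_letter_def)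
    moreover have "inv\<^bsub>free_group A\<^esub> [(i, True)] \<in> generate (free_group A) ?S"
      using that by (intro generate.inv) auto
    ultimately show ?thesis using False by simp
  qed (use that in \<open>auto intro: generate.incl\<close>)
  have "w \<in> generate (free_group A) ?S" if "set w \<subseteq> A \<times> UNIV" "reduced w" for w
    using that
  proof (induction w)
    case Nil
    show ?case using generate.one[of "free_group A" ?S] by (simp add: free_group_def)
  next
    case (Cons a w)
    have "[a] \<otimes>\<^bsub>free_group A\<^esub> w = a # w"
      using Cons.prems by (simp add: free_group_def free_reduce_reduced)
    moreover have "[a] \<in> generate (free_group A) ?S"
      using letter[of "fst a" "snd a"] Cons.prems by auto
    moreover have "w \<in> generate (free_group A) ?S"
      using Cons.IH Cons.prems(1) reduced_ConsD[OF Cons.prems(2)] by simp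
    ultimately show ?case using generate.eng by metis
  qed
  then show "carrier (free_group A) \<subseteq> generate (free_group A) ?S"
    by (auto simp: free_group_def)
qed

lemma (in group) normal_closure_least: "N \<lhd> G \<Longrightarrow> S \<subseteq> N \<Longrightarrow> normal_closure G S \<subseteq> N"
  by (auto simp: normal_closure_def)

definition tilde_gen :: "nat \<Rightarrow> nat \<Rightarrow> nat \<Rightarrow> nat letter list set set" where
  "tilde_gen n r i = squares_closure n r #>\<^bsub>free_nilpotent n r\<^esub> free_nilpotent_gen n r i"

lemma tilde_gens: "free_nilpotent_tilde_gens n r = tilde_gen n r ` {1..n}"
  by (simp add: free_nilpotent_tilde_gens_def tilde_gen_def)

lemma free_generator_carrier: "i \<in> A \<Longrightarrow> [(i, True)] \<in> carrier (free_group A)"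
  by (auto simp: free_group_def reduced_def)

context
  fixes n r :: nat
begin

interpretation F: group "free_group_rank n" by (rule group_free_group)

lemma normal_gamma: "lower_central (free_group_rank n) (r + 1) \<lhd> free_group_rank n"
  by (rule F.normal_lower_central)

interpretation N: group "free_nilpotent n r"
  unfolding free_nilpotent_def using normal_gamma by (rule normal.factorgroup_is_group)

interpretation p: group_hom "free_group_rank n" "free_nilpotent n r"
    "\<lambda>x. lower_central (free_group_rank n) (r + 1) #>\<^bsub>free_group_rank n\<^esub> x"
  unfolding free_nilpotent_def by (rule F.hom_to_quotient(1)[OF normal_gamma])

lemma nilpotent_gen_carrier: "i \<in> {1..n} \<Longrightarrow> free_nilpotent_gen n r i \<in> carrier (free_nilpotent n r)"
  unfolding free_nilpotent_gen_def by (intro p.hom_closed free_generator_carrier)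

lemma squares_carrier:
  "(\<lambda>i. free_nilpotent_gen n r i [^]\<^bsub>free_nilpotent n r\<^esub> (2::nat)) ` {1..n} \<subseteq> carrier (free_nilpotent n r)"
  using nilpotent_gen_carrier by auto

lemma normal_squares: "squares_closure n r \<lhd> free_nilpotent n r"
  unfolding squares_closure_def using squares_carrier by (rule N.normal_closure_normal)

interpretation q: group_hom "free_nilpotent n r" "free_nilpotent_tilde n r"
    "\<lambda>x. squares_closure n r #>\<^bsub>free_nilpotent n r\<^esub> x"
  unfolding free_nilpotent_tilde_def by (rule N.hom_to_quotient(1)[OF normal_squares])

lemma surjections:
  "(\<lambda>x. lower_central (free_group_rank n) (r + 1) #>\<^bsub>free_group_rank n\<^esub> x) ` carrier (free_group_rank n)
    = carrier (free_nilpotent n r)"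
  "(\<lambda>x. squares_closure n r #>\<^bsub>free_nilpotent n r\<^esub> x) ` carrier (free_nilpotent n r)
    = carrier (free_nilpotent_tilde n r)"
  unfolding free_nilpotent_tilde_def free_nilpotent_def by (simp_all add: carrier_FactGroup)

lemma involution_generated_tilde:
  "involution_generated (free_nilpotent_tilde n r) (tilde_gen n r) {1..n}"
proof (intro involution_generated.intro involution_generated_axioms.intro)
  show "group (free_nilpotent_tilde n r)" by (rule q.H.group_axioms)
  fix i assume i: "i \<in> {1..n}"
  show "tilde_gen n r i \<in> carrier (free_nilpotent_tilde n r)"
    unfolding tilde_gen_def using nilpotent_gen_carrier[OF i] by (rule q.hom_closed)
  let ?x = "free_nilpotent_gen n r i"
  have "?x \<otimes>\<^bsub>free_nilpotent n r\<^esub> ?x = ?x [^]\<^bsub>free_nilpotent n r\<^esub> (2::nat)"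
    using nilpotent_gen_carrier[OF i] by (simp add: N.nat_pow_Suc numeral_2_eq_2)
  also have "\<dots> \<in> squares_closure n r"
    unfolding squares_closure_def using i N.normal_closure_superset by fast
  finally have "squares_closure n r #>\<^bsub>free_nilpotent n r\<^esub> (?x \<otimes>\<^bsub>free_nilpotent n r\<^esub> ?x)
      = \<one>\<^bsub>free_nilpotent_tilde n r\<^esub>"
    using N.hom_to_quotient(3)[OF normal_squares N.m_closed] nilpotent_gen_carrier[OF i]
    unfolding free_nilpotent_tilde_def by blast
  then show "tilde_gen n r i \<otimes>\<^bsub>free_nilpotent_tilde n r\<^esub> tilde_gen n r i = \<one>\<^bsub>free_nilpotent_tilde n r\<^esub>"
    unfolding tilde_gen_def using nilpotent_gen_carrier[OF i] by (simp only: q.hom_mult)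
next
  have "generate (free_nilpotent n r) (free_nilpotent_gen n r ` {1..n}) = carrier (free_nilpotent n r)"
    using p.generate_img[of "(\<lambda>i. [(i, True)]) ` {1..n}"] free_generator_carrier[of _ "{1..n}"]
    unfolding generate_free_group surjections(1) image_image free_nilpotent_gen_def by blast
  then show "generate (free_nilpotent_tilde n r) (tilde_gen n r ` {1..n}) = carrier (free_nilpotent_tilde n r)"
    using q.generate_img[of "free_nilpotent_gen n r ` {1..n}"] nilpotent_gen_carrier surjections(2)
    unfolding image_image tilde_gen_def by (simp only: image_subset_iff) blast
qed

lemma nilpotent_tilde: "lower_central (free_nilpotent_tilde n r) (Suc r) = {\<one>\<^bsub>free_nilpotent_tilde n r\<^esub>}"
proof -
  let ?\<gamma> = "lower_central (free_group_rank n) (r + 1)"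
  have "(\<lambda>x. ?\<gamma> #>\<^bsub>free_group_rank n\<^esub> x) ` ?\<gamma> \<subseteq> {\<one>\<^bsub>free_nilpotent n r\<^esub>}"
  proof clarify
    fix x assume x: "x \<in> ?\<gamma>"
    then show "?\<gamma> #>\<^bsub>free_group_rank n\<^esub> x = \<one>\<^bsub>free_nilpotent n r\<^esub>"
      using F.hom_to_quotient(3)[OF normal_gamma F.lower_central_carrier[OF x]]
      unfolding free_nilpotent_def by blast
  qed
  then have "lower_central (free_nilpotent n r) (r + 1) \<subseteq> {\<one>\<^bsub>free_nilpotent n r\<^esub>}"
    unfolding p.lower_central_image[OF surjections(1)] .
  then have "lower_central (free_nilpotent_tilde n r) (r + 1) \<subseteq> {\<one>\<^bsub>free_nilpotent_tilde n r\<^esub>}"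
    unfolding q.lower_central_image[OF surjections(2)] using q.hom_one by auto
  moreover have "\<one>\<^bsub>free_nilpotent_tilde n r\<^esub> \<in> lower_central (free_nilpotent_tilde n r) (r + 1)"
    using normal_imp_subgroup[OF q.H.normal_lower_central] by (rule subgroup.one_closed)
  ultimately show ?thesis by auto
qed

text \<open>The universal property of \<open>N\<^sub>n\<^sub>,\<^sub>r\<close> modulo the squares of its basis: it is the largest group of class
  at most \<open>r\<close> generated by \<open>n\<close> involutions.  The map from the free group factors through each of the
  two quotients in turn.\<close>

lemma hom_from_tilde:
  assumes "group H" "lower_central H (Suc r) = {\<one>\<^bsub>H\<^esub>}"
    and v: "\<And>i. i \<in> {1..n} \<Longrightarrow> v i \<in> carrier H" "\<And>i. i \<in> {1..n} \<Longrightarrow> v i \<otimes>\<^bsub>H\<^esub> v i = \<one>\<^bsub>H\<^esub>"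
  shows "\<exists>\<psi> \<in> hom (free_nilpotent_tilde n r) H. \<forall>i\<in>{1..n}. \<psi> (tilde_gen n r i) = v i"
proof -
  interpret H: group H by fact
  obtain \<phi> where \<phi>: "\<phi> \<in> hom (free_group_rank n) H" "\<And>i. i \<in> {1..n} \<Longrightarrow> \<phi> [(i, True)] = v i"
    using free_group_hom[OF assms(1), of "{1..n}" v] v(1) by blast
  interpret \<phi>: group_hom "free_group_rank n" H \<phi> using \<phi>(1) by unfold_locales
  have "lower_central (free_group_rank n) (r + 1) \<subseteq> kernel (free_group_rank n) H \<phi>"
    using \<phi>.lower_central_image_subset[of "r + 1"] assms(2) F.lower_central_carrier
    by (auto simp: kernel_def)
  then obtain \<phi>' where \<phi>': "\<phi>' \<in> hom (free_nilpotent n r) H"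
    "\<And>x. x \<in> carrier (free_group_rank n) \<Longrightarrow>
      \<phi>' (lower_central (free_group_rank n) (r + 1) #>\<^bsub>free_group_rank n\<^esub> x) = \<phi> x"
    using \<phi>.FactGroup_universal_kernel[OF normal_gamma] unfolding free_nilpotent_def by blast
  interpret \<phi>': group_hom "free_nilpotent n r" H \<phi>' using \<phi>'(1) by unfold_locales
  have gen: "\<phi>' (free_nilpotent_gen n r i) = v i" if "i \<in> {1..n}" for i
    unfolding free_nilpotent_gen_def using \<phi>'(2)[OF free_generator_carrier[OF that]] \<phi>(2)[OF that] by simp
  have "squares_closure n r \<subseteq> kernel (free_nilpotent n r) H \<phi>'"
    unfolding squares_closure_def
  proof (rule N.normal_closure_least[OF \<phi>'.normal_kernel], clarify)
    fix i assume i: "i \<in> {1..n}"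
    show "free_nilpotent_gen n r i [^]\<^bsub>free_nilpotent n r\<^esub> (2::nat) \<in> kernel (free_nilpotent n r) H \<phi>'"
      using nilpotent_gen_carrier[OF i] gen[OF i] v[OF i]
      by (simp add: kernel_def N.nat_pow_Suc numeral_2_eq_2)
  qed
  then obtain \<psi> where \<psi>: "\<psi> \<in> hom (free_nilpotent_tilde n r) H"
    "\<And>x. x \<in> carrier (free_nilpotent n r) \<Longrightarrow> \<psi> (squares_closure n r #>\<^bsub>free_nilpotent n r\<^esub> x) = \<phi>' x"
    using \<phi>'.FactGroup_universal_kernel[OF normal_squares] unfolding free_nilpotent_tilde_def by blast
  have "\<psi> (tilde_gen n r i) = v i" if "i \<in> {1..n}" for i
    unfolding tilde_gen_def using \<psi>(2) nilpotent_gen_carrier[OF that] gen[OF that] by simp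
  with \<psi>(1) show ?thesis by blast
qed

end

lemma palindromic_width_tilde_ge:
  assumes "n \<ge> 2" "r \<ge> 2"
  shows "enat (2 * (n - 1)) \<le> palindromic_width (free_nilpotent_tilde n r) (free_nilpotent_tilde_gens n r)"
proof -
  interpret involution_generated "free_nilpotent_tilde n r" "tilde_gen n r" "{1..n}"
    by (rule involution_generated_tilde)
  have "enat (2 * (card {1..n} - 1))
      \<le> palindromic_width (free_nilpotent_tilde n r) (tilde_gen n r ` {1..n})"
  proof (rule palindromic_width_ge)
    fix i j :: nat assume "i \<noteq> j"
    then show "\<exists>\<psi>\<in>hom (free_nilpotent_tilde n r) unitriangular.
        \<forall>m\<in>{1..n}. \<psi> (tilde_gen n r m) = (m = i, m = j, False)"
      using assms(2) by (intro hom_from_tilde lower_central_unitriangular U.group_axioms) auto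
  qed (use assms in auto)
  then show ?thesis by (simp add: tilde_gens)
qed

theorem theorem1p1:
  shows "(\<forall>n r :: nat. n \<ge> 2 \<and> r \<ge> 2 \<longrightarrow>
            enat n \<le> palindromic_width (free_nilpotent_tilde n r) (free_nilpotent_tilde_gens n r) \<and>
            palindromic_width (free_nilpotent_tilde n r) (free_nilpotent_tilde_gens n r) \<le> enat (2 * n))
       \<and> (\<forall>n :: nat. n \<ge> 2 \<longrightarrow>
            palindromic_width (free_nilpotent_tilde n 2) (free_nilpotent_tilde_gens n 2) = enat (2 * (n - 1)))"
proof (intro conjI allI impI)
  fix n r :: nat
  assume nr: "n \<ge> 2 \<and> r \<ge> 2"
  have "n \<le> 2 * (n - 1)" using nr by linarith
  then have "enat n \<le> enat (2 * (n - 1))" by simp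
  also have "\<dots> \<le> palindromic_width (free_nilpotent_tilde n r) (free_nilpotent_tilde_gens n r)"
    using nr by (intro palindromic_width_tilde_ge) auto
  finally show "enat n \<le> palindromic_width (free_nilpotent_tilde n r) (free_nilpotent_tilde_gens n r)" .
  show "palindromic_width (free_nilpotent_tilde n r) (free_nilpotent_tilde_gens n r) \<le> enat (2 * n)"
    using involution_generated.palindromic_width_le_twice_rank[OF involution_generated_tilde _ _ nilpotent_tilde, of n r] nr
    by (simp add: tilde_gens)
next
  fix n :: nat
  assume n: "n \<ge> 2"
  have "lower_central (free_nilpotent_tilde n 2) 3 = {\<one>\<^bsub>free_nilpotent_tilde n 2\<^esub>}"
    using nilpotent_tilde[of n 2] by (simp add: numeral_3_eq_3 numeral_2_eq_2)
  then have "palindromic_width (free_nilpotent_tilde n 2) (free_nilpotent_tilde_gens n 2) \<le> enat (2 * (n - 1))"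
    using involution_generated.palindromic_width_le_class_two[OF involution_generated_tilde, of n 2] n
    by (simp add: tilde_gens)
  moreover have "enat (2 * (n - 1)) \<le> palindromic_width (free_nilpotent_tilde n 2) (free_nilpotent_tilde_gens n 2)"
    using n by (intro palindromic_width_tilde_ge) auto
  ultimately show "palindromic_width (free_nilpotent_tilde n 2) (free_nilpotent_tilde_gens n 2) = enat (2 * (n - 1))"
    by (rule antisym)
qed

end
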